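(* The supervisory control algorithm SUPERVISOR described in the context is non-blocking; that is, if $\mathrm{SUPERVISOR}(\mathbf{x}(0),\dot{\mathbf{x}}(0),\mathbf{u}_d^0)\neq\emptyset$, then (for every time step $k$) for any $\mathbf{u}_d^k\in\mathbf{U}$, $\mathrm{SUPERVISOR}(\mathbf{x}(k\tau),\dot{\mathbf{x}}(k\tau),\mathbf{u}_d^k)\neq\emptyset$.
   Context: **Vehicles.** There are $n$ vehicles. Vehicle $j\in\{1,\ldots,n\}$ has position $x_j\in X_j\subseteq\mathbb{R}$ along its predefined longitudinal path and speed $\dot{x}_j\in\dot{X}_j=[\dot{x}_{j,min},\dot{x}_{j,max}]\subset\mathbb{R}$ with $\dot{x}_{j,min}>0$, and dynamics $\ddot{x}_j=f_j(x_j,\dot{x}_j,u_j)$ with input $u_j\in U_j=[u_{j,min},u_{j,max}]\subset\mathbb{R}$. Input signals $u_j(\cdot):t\mapsto u_j(t)\in U_j$ lie in a signal space $\mathcal{U}_j$. $x_j(t,u_j(\cdot),x_j(0),\dot{x}_j(0))$ and $\dot{x}_j(t,u_j(\cdot),x_j(0),\dot{x}_j(0))$ are the position and speed at time $t$ starting from $(x_j(0),\dot{x}_j(0))$ under $u_j(\cdot)$; likewise $x_j(t,u_j(\cdot),a,b)$ starts from position $a$ with speed $b$. Boldface denotes the aggregate over $j$: $\mathbf{x}=(x_1,\ldots,x_n)\in\mathbf{X}$, $\dot{\mathbf{x}}\in\dot{\mathbf{X}}$, $\mathbf{u}\in\mathbf{U}$, $\mathbf{u}(\cdot)\in\mathcal{U}$,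 and $\mathbf{x}(t,\mathbf{u}(\cdot),\cdot,\cdot)$, $\dot{\mathbf{x}}(t,\mathbf{u}(\cdot),\cdot,\cdot)$ are aggregate position and speed. Assumption 1: for all $j$, $x_j(t,u_j(\cdot),x_j(0),\dot{x}_j(0))$ depends continuously on $u_j(\cdot)\in\mathcal{U}_j$, and $\mathcal{U}_j$ is path-connected. Assumption 2 (monotonicity): write $u_j(\cdot)\le u_j'(\cdot)$ if $u_j(t)\le u_j'(t)$ for all $t\ge0$. For all $j$, if $u_j(\cdot)\le u'_j(\cdot)$, $x_j(0)\le x'_j(0)$, $\dot{x}_j(0)\le\dot{x}'_j(0)$ and $0\le t\le t'$, then $x_j(t,u_j(\cdot),x_j(0),\dot{x}_j(0))\le x_j(t',u'_j(\cdot),x'_j(0),\dot{x}'_j(0))$. **Intersection and operations.** The intersection is a collection of $m$ conflict areas; conflict area $i$ occupies the open interval $(\alpha_{ij},\beta_{ij})\subset\mathbb{R}$ on the path of vehicle $j$ (if it lies on that path); conflict areas on a path are crossed one after another (if vehicle $j$ crosses $i$ and then $i'$, then $\beta_{ij}\le\alpha_{i'j}$). $\bar{\mathcal{N}}$ is the set of operations $(i,j)\in\{1,\ldots,m\}\times\{1,\ldots,n\}$ such that conflict area $i$ is on the route of vehicle $j$. Given $\mathbf{x}(0)$, $\mathcal{N}=\{(i,j)\in\bar{\mathcal{N}}: x_j(0)<\beta_{ij}\}$. $\mathcal{F}\subseteq\mathcal{N}$ is the set of operations $(i,j)\in\mathcal{N}$ that are the first operation of vehicle $j$ in $\mathcal{N}$.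 The disjunctive arcs $\mathcal{D}$ are the arcs $(i,j)\leftrightarrow(i,j')$ between operations in $\mathcal{N}$ with $j\ne j'$ (vehicles $j$ and $j'$ share conflict area $i$). **Upper bound problem** (for an initial condition $(\mathbf{x}(0),\dot{\mathbf{x}}(0))$). Let $\alpha_{j,min}=\min_{(i,j)\in\bar{\mathcal{N}}}\alpha_{ij}$. The decision variables are $\mathbf{T}^{\mathcal{F}}=\{T^{\mathcal{F}}_{ij}:(i,j)\in\mathcal{F}\}$, where $x_j(T^{\mathcal{F}}_{ij},u_j(\cdot),x_j(0),\dot{x}_j(0))=\alpha_{ij}$ for some $u_j(\cdot)\in\mathcal{U}_j$ if $x_j(0)<\alpha_{ij}$, and $T^{\mathcal{F}}_{ij}=0$ otherwise; and $\mathbf{k}=\{k_{ijj'}\in\{0,1\}\}$ for $(i,j)\leftrightarrow(i,j')\in\mathcal{D}$. Write $\tau_j(a,b;c)=\min_{u_j(\cdot)\in\mathcal{U}_j}\{t: x_j(t,u_j(\cdot),a,b)=c\}$. - For $(i,j)\in\mathcal{F}$: if $x_j(0)<\alpha_{j,min}$, $\bar{R}_{ij}=\min_{u_j(\cdot)\in\mathcal{U}_j}\{t:x_j(t,u_j(\cdot),x_j(0),\dot{x}_j(0))=\alpha_{j,min}\}$ and $\bar{D}_{ij}=\max_{u_j(\cdot)\in\mathcal{U}_j}\{t:x_j(t,u_j(\cdot),x_j(0),\dot{x}_j(0))=\alpha_{j,min}\}$; if $\alpha_{j,min}\le x_j(0)<\alpha_{ij}$, $\bar{R}_{ij}=\bar{D}_{ij}=\tau_j(x_j(0),\dot{x}_j(0);\alpha_{ij})$;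 if $\alpha_{ij}\le x_j(0)$, $\bar{R}_{ij}=\bar{D}_{ij}=0$. - If $x_j(0)<\alpha_{j,min}$: for $(i,j)\in\mathcal{F}$, $\bar{T}_{ij}=T^{\mathcal{F}}_{ij}$, $\bar{P}_{ij}=T^{\mathcal{F}}_{ij}+\tau_j(\alpha_{ij},\dot{x}_{j,min};\beta_{ij})$; for $(i,j)\in\mathcal{N}\setminus\mathcal{F}$, with $(i',j)\in\mathcal{F}$ the first operation of vehicle $j$ (so $\alpha_{i'j}=\alpha_{j,min}$), $\bar{T}_{ij}=T^{\mathcal{F}}_{i'j}+\tau_j(\alpha_{j,min},\dot{x}_{j,max};\alpha_{ij})$, $\bar{P}_{ij}=T^{\mathcal{F}}_{i'j}+\tau_j(\alpha_{j,min},\dot{x}_{j,min};\beta_{ij})$. - If $\alpha_{j,min}\le x_j(0)$: for $(i,j)\in\mathcal{F}$, $\bar{T}_{ij}=T^{\mathcal{F}}_{ij}$, $\bar{P}_{ij}=T^{\mathcal{F}}_{ij}-\bar{R}_{ij}+\tau_j(x_j(0),\dot{x}_j(0);\beta_{ij})$; for $(i,j)\in\mathcal{N}\setminus\mathcal{F}$, with $(i',j)\in\mathcal{F}$ the first operation of vehicle $j$, $\bar{T}_{ij}=T^{\mathcal{F}}_{i'j}-\bar{R}_{i'j}+\tau_j(x_j(0),\dot{x}_j(0);\alpha_{ij})$, $\bar{P}_{ij}=T^{\mathcal{F}}_{i'j}-\bar{R}_{i'j}+\tau_j(x_j(0),\dot{x}_j(0);\beta_{ij})$. Then $$s_U^*=\min_{\mathbf{T}^{\mathcal{F}},\mathbf{k}}\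 \max_{(i,j)\in\mathcal{F}}\big(T^{\mathcal{F}}_{ij}-\bar{D}_{ij},0\big)$$ subject to: $\bar{R}_{ij}\le T^{\mathcal{F}}_{ij}$ for all $(i,j)\in\mathcal{F}$; and for all $(i,j)\leftrightarrow(i,j')\in\mathcal{D}$: $\bar{P}_{ij}\le\bar{T}_{ij'}+M(1-k_{ijj'})$, $\bar{P}_{ij'}\le\bar{T}_{ij}+M(1-k_{ij'j})$, $k_{ijj'}+k_{ij'j}=1$, where $M>0$ is a large number (big-M constant). An infeasible problem has value $+\infty$. $\mathrm{APPROXVERIFICATION}(\mathbf{x}(0),\dot{\mathbf{x}}(0))$ returns $(s_U^*,\mathbf{T}^{\mathcal{F}*})$, where $\mathbf{T}^{\mathcal{F}*}$ is an optimal solution of the upper bound problem for the given initial condition. **Input generator.** For a state $(\mathbf{y},\dot{\mathbf{y}})$ and a schedule $\mathbf{T}^{\mathcal{F}*}$, $\sigma(\mathbf{y},\dot{\mathbf{y}},\mathbf{T}^{\mathcal{F}*})$ is an element of $$\{\mathbf{u}(\cdot)\in\mathcal{U}: \text{for all }(i,j)\in\mathcal{F},\ x_j(T_{ij}^{\mathcal{F}*},u_j(\cdot),y_j,\dot{y}_j)=\alpha_{ij}\text{ and }u_j(t)=u_{j,max}\ \forall t\ge T_{ij}^{\mathcal{F}*}\}.$$ **SUPERVISOR$(\mathbf{x}(k\tau),\dot{\mathbf{x}}(k\tau),\mathbf{u}_d^k)$** (executed at time $k\tau$, $k=0,1,2,\ldots$, with time step $\tau>0$; $\mathbf{u}_d^k\in\mathbf{U}$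 is the drivers' desired input, and $\mathbf{u}_d^k(\cdot):[0,\tau)\to\mathbf{U}$ is the constant signal $t\mapsto\mathbf{u}_d^k$): 1. $\mathbf{x}_d^k\leftarrow\mathbf{x}(\tau,\mathbf{u}_d^k(\cdot),\mathbf{x}(k\tau),\dot{\mathbf{x}}(k\tau))$ and $\dot{\mathbf{x}}_d^k\leftarrow\dot{\mathbf{x}}(\tau,\mathbf{u}_d^k(\cdot),\mathbf{x}(k\tau),\dot{\mathbf{x}}(k\tau))$. 2. $(s_U^*,\mathbf{T}_1^{\mathcal{F}*})\leftarrow\mathrm{APPROXVERIFICATION}(\mathbf{x}_d^k,\dot{\mathbf{x}}_d^k)$. 3. If $s_U^*=0$: set $\mathbf{u}_{safe}^{k+1,\infty}(\cdot)\leftarrow\sigma(\mathbf{x}_d^k,\dot{\mathbf{x}}_d^k,\mathbf{T}_1^{\mathcal{F}*})$ (a signal on $[0,\infty)$), store its restriction $\mathbf{u}_{safe}^{k+1}(\cdot)$ to $[0,\tau)$, and return $\mathbf{u}_d^k(\cdot)$. 4. Otherwise, using the signal $\mathbf{u}_{safe}^k(\cdot)$ stored at the previous step: $\mathbf{x}_{safe}^k\leftarrow\mathbf{x}(\tau,\mathbf{u}_{safe}^k(\cdot),\mathbf{x}(k\tau),\dot{\mathbf{x}}(k\tau))$, $\dot{\mathbf{x}}_{safe}^k\leftarrow\dot{\mathbf{x}}(\tau,\mathbf{u}_{safe}^k(\cdot),\mathbf{x}(k\tau),\dot{\mathbf{x}}(k\tau))$; $(\cdot,\mathbf{T}_2^{\mathcal{F}*})\leftarrow\mathrm{APPROXVERIFICATION}(\mathbf{x}_{safe}^k,\dot{\mathbf{x}}_{safe}^k)$;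 set $\mathbf{u}_{safe}^{k+1,\infty}(\cdot)\leftarrow\sigma(\mathbf{x}_{safe}^k,\dot{\mathbf{x}}_{safe}^k,\mathbf{T}_2^{\mathcal{F}*})$, store its restriction $\mathbf{u}_{safe}^{k+1}(\cdot)$ to $[0,\tau)$, and return $\mathbf{u}_{safe}^k(\cdot)$. The returned signal is applied to the vehicles on $[k\tau,(k+1)\tau)$ and determines $(\mathbf{x}((k+1)\tau),\dot{\mathbf{x}}((k+1)\tau))$. $\mathrm{SUPERVISOR}(\cdot)\ne\emptyset$ means that the algorithm returns an input signal (all signals it has to construct or use being well-defined). At $k=0$ no safe input from a previous step is stored, so a nonempty output at $k=0$ is obtained through step 3.
   Formalization: The input generator must reach α_ij at T_ij only if y_j < α_ij (otherwise its set is empty once a vehicle is inside a conflict area), and the signal spaces are assumed to contain constants and be closed under time shift and concatenation. *)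

theory Defs
  imports "HOL-Analysis.Analysis" "HOL-Library.Monad_Syntax"
begin

section \<open>Vehicles and intersection\<close>

text \<open>
  Vehicles are numbered \<open>1..n_veh\<close>, conflict areas \<open>1..n_conf\<close>; families indexed by them are
  functions on \<open>nat\<close>, of which only the values at these indices matter.  Likewise an input signal
  is a function on \<open>real\<close> of which only the values at times \<open>t \<ge> 0\<close> matter.  The signal space of
  vehicle \<open>j\<close> is the carrier of the topology \<open>sig_top S j\<close>, which is left arbitrary.  In
  \<open>pos S j t u a b\<close> and \<open>vel S j t u a b\<close>, \<open>(a, b)\<close> is the initial position and speed.
\<close>

record intersection =
  n_veh :: nat
  n_conf :: nat
  X :: "nat \<Rightarrow> real set"
  vmin :: "nat \<Rightarrow> real"
  vmax :: "nat \<Rightarrow> real"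
  umin :: "nat \<Rightarrow> real"
  umax :: "nat \<Rightarrow> real"
  acc :: "nat \<Rightarrow> real \<Rightarrow> real \<Rightarrow> real \<Rightarrow> real"
  sig_top :: "nat \<Rightarrow> (real \<Rightarrow> real) topology"
  pos :: "nat \<Rightarrow> real \<Rightarrow> (real \<Rightarrow> real) \<Rightarrow> real \<Rightarrow> real \<Rightarrow> real"
  vel :: "nat \<Rightarrow> real \<Rightarrow> (real \<Rightarrow> real) \<Rightarrow> real \<Rightarrow> real \<Rightarrow> real"
  ops :: "(nat \<times> nat) set"
  \<alpha> :: "nat \<Rightarrow> nat \<Rightarrow> real"
  \<beta> :: "nat \<Rightarrow> nat \<Rightarrow> real"

type_synonym state = "(nat \<Rightarrow> real) \<times> (nat \<Rightarrow> real)"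
type_synonym input = "nat \<Rightarrow> real"
type_synonym signals = "nat \<Rightarrow> real \<Rightarrow> real"
type_synonym schedule = "nat \<Rightarrow> nat \<Rightarrow> real"

definition vehicles :: "intersection \<Rightarrow> nat set" where
  "vehicles S = {1..n_veh S}"

definition V :: "intersection \<Rightarrow> nat \<Rightarrow> real set" where
  "V S j = {vmin S j..vmax S j}"

definition sig_space :: "intersection \<Rightarrow> nat \<Rightarrow> (real \<Rightarrow> real) set" where
  "sig_space S j = topspace (sig_top S j)"

definition states :: "intersection \<Rightarrow> state set" where
  "states S = {(x, v). \<forall>j\<in>vehicles S. x j \<in> X S j \<and> v j \<in> V S j}"

definition inputs :: "intersection \<Rightarrow> input set" where
  "inputs S = {w. \<forall>j\<in>vehicles S. w j \<in> {umin S j..umax S j}}"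

text \<open>
  The second-order dynamics in integrated form (the input may jump, so the speed need not be
  differentiable everywhere), with the state confined to its state space.
\<close>

definition trajectory ::
  "intersection \<Rightarrow> nat \<Rightarrow> (real \<Rightarrow> real) \<Rightarrow> real \<Rightarrow> real \<Rightarrow> (real \<Rightarrow> real) \<Rightarrow> (real \<Rightarrow> real) \<Rightarrow> bool"
where
  "trajectory S j u a b p v \<longleftrightarrow>
     (\<forall>t\<ge>0. p t \<in> X S j \<and> v t \<in> V S j \<and>
            (v has_integral (p t - a)) {0..t} \<and>
            ((\<lambda>s. acc S j (p s) (v s) (u s)) has_integral (v t - b)) {0..t})"

definition well_posed_flow :: "intersection \<Rightarrow> bool" where
  "well_posed_flow S \<longleftrightarrow>
     (\<forall>j\<in>vehicles S. \<forall>u\<in>sig_space S j. \<forall>a\<in>X S j. \<forall>b\<in>V S j.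
        trajectory S j u a b (\<lambda>t. pos S j t u a b) (\<lambda>t. vel S j t u a b) \<and>
        (\<forall>p v. trajectory S j u a b p v \<longrightarrow>
           (\<forall>t\<ge>0. p t = pos S j t u a b \<and> v t = vel S j t u a b)))"

text \<open>
  The closure conditions make the signals used by the controller admissible: constant desired
  inputs, inputs that switch to the maximal input, and inputs restarted at a later sampling time.
\<close>

definition admissible_signals :: "intersection \<Rightarrow> bool" where
  "admissible_signals S \<longleftrightarrow>
     (\<forall>j\<in>vehicles S.
        (\<forall>u\<in>sig_space S j. \<forall>t\<ge>0. u t \<in> {umin S j..umax S j}) \<and>
        (\<forall>c\<in>{umin S j..umax S j}. (\<lambda>t. c) \<in> sig_space S j) \<and>
        (\<forall>u\<in>sig_space S j. \<forall>s\<ge>0. (\<lambda>t. u (t + s)) \<in> sig_space S j) \<and>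
        (\<forall>u\<in>sig_space S j. \<forall>w\<in>sig_space S j. \<forall>s\<ge>0.
           (\<lambda>t. if t < s then u t else w (t - s)) \<in> sig_space S j))"

definition intersection_geometry :: "intersection \<Rightarrow> bool" where
  "intersection_geometry S \<longleftrightarrow>
     ops S \<subseteq> {1..n_conf S} \<times> vehicles S \<and>
     (\<forall>(i, j)\<in>ops S. \<alpha> S i j < \<beta> S i j) \<and>
     (\<forall>i i' j. (i, j) \<in> ops S \<longrightarrow> (i', j) \<in> ops S \<longrightarrow> i \<noteq> i' \<longrightarrow>
        \<beta> S i j \<le> \<alpha> S i' j \<or> \<beta> S i' j \<le> \<alpha> S i j)"

definition intersection_model :: "intersection \<Rightarrow> bool" where
  "intersection_model S \<longleftrightarrow>
     (\<forall>j\<in>vehicles S. 0 < vmin S j \<and> vmin S j \<le> vmax S j \<and> umin S j \<le> umax S j) \<and>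
     admissible_signals S \<and> well_posed_flow S \<and> intersection_geometry S"

definition continuous_inputs :: "intersection \<Rightarrow> bool" where
  "continuous_inputs S \<longleftrightarrow>
     (\<forall>j\<in>vehicles S. path_connected_space (sig_top S j) \<and>
        (\<forall>t\<ge>0. \<forall>a\<in>X S j. \<forall>b\<in>V S j.
           continuous_map (sig_top S j) euclideanreal (\<lambda>u. pos S j t u a b)))"

definition monotone_flow :: "intersection \<Rightarrow> bool" where
  "monotone_flow S \<longleftrightarrow>
     (\<forall>j\<in>vehicles S. \<forall>u\<in>sig_space S j. \<forall>u'\<in>sig_space S j.
      \<forall>a\<in>X S j. \<forall>a'\<in>X S j. \<forall>b\<in>V S j. \<forall>b'\<in>V S j. \<forall>t t'.
        (\<forall>s\<ge>0. u s \<le> u' s) \<longrightarrow> a \<le> a' \<longrightarrow> b \<le> b' \<longrightarrow> 0 \<le> t \<longrightarrow> t \<le> t' \<longrightarrow>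
        pos S j t u a b \<le> pos S j t' u' a' b')"

definition evolve :: "intersection \<Rightarrow> real \<Rightarrow> signals \<Rightarrow> state \<Rightarrow> state" where
  "evolve S t u = (\<lambda>(x, v). (\<lambda>j. pos S j t (u j) (x j) (v j), \<lambda>j. vel S j t (u j) (x j) (v j)))"


section \<open>Upper bound problem\<close>

definition active_ops :: "intersection \<Rightarrow> (nat \<Rightarrow> real) \<Rightarrow> (nat \<times> nat) set" where
  "active_ops S x = {(i, j) \<in> ops S. x j < \<beta> S i j}"

definition first_ops :: "intersection \<Rightarrow> (nat \<Rightarrow> real) \<Rightarrow> (nat \<times> nat) set" where
  "first_ops S x = {(i, j) \<in> active_ops S x. \<forall>i'. (i', j) \<in> active_ops S x \<longrightarrow> \<alpha> S i j \<le> \<alpha> S i' j}"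

definition first_of :: "intersection \<Rightarrow> (nat \<Rightarrow> real) \<Rightarrow> nat \<Rightarrow> nat" where
  "first_of S x j = (THE i. (i, j) \<in> first_ops S x)"

text \<open>An arc between \<open>(i, j)\<close> and \<open>(i, j')\<close> is represented by both \<open>(i, j, j')\<close> and \<open>(i, j', j)\<close>.\<close>

definition arcs :: "intersection \<Rightarrow> (nat \<Rightarrow> real) \<Rightarrow> (nat \<times> nat \<times> nat) set" where
  "arcs S x = {(i, j, j'). (i, j) \<in> active_ops S x \<and> (i, j') \<in> active_ops S x \<and> j \<noteq> j'}"

definition \<alpha>min :: "intersection \<Rightarrow> nat \<Rightarrow> real" where
  "\<alpha>min S j = Min {\<alpha> S i j | i. (i, j) \<in> ops S}"

definition hit_times :: "intersection \<Rightarrow> nat \<Rightarrow> real \<Rightarrow> real \<Rightarrow> real \<Rightarrow> real set" where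
  "hit_times S j a b c = {t. 0 \<le> t \<and> (\<exists>u\<in>sig_space S j. pos S j t u a b = c)}"

definition min_time :: "intersection \<Rightarrow> nat \<Rightarrow> real \<Rightarrow> real \<Rightarrow> real \<Rightarrow> real" where
  "min_time S j a b c = Inf (hit_times S j a b c)"

definition max_time :: "intersection \<Rightarrow> nat \<Rightarrow> real \<Rightarrow> real \<Rightarrow> real \<Rightarrow> real" where
  "max_time S j a b c = Sup (hit_times S j a b c)"

fun R_bar :: "intersection \<Rightarrow> state \<Rightarrow> nat \<Rightarrow> nat \<Rightarrow> real" where
  "R_bar S (x, v) i j =
     (if x j < \<alpha>min S j then min_time S j (x j) (v j) (\<alpha>min S j)
      else if x j < \<alpha> S i j then min_time S j (x j) (v j) (\<alpha> S i j)
      else 0)"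

fun D_bar :: "intersection \<Rightarrow> state \<Rightarrow> nat \<Rightarrow> nat \<Rightarrow> real" where
  "D_bar S (x, v) i j =
     (if x j < \<alpha>min S j then max_time S j (x j) (v j) (\<alpha>min S j)
      else if x j < \<alpha> S i j then min_time S j (x j) (v j) (\<alpha> S i j)
      else 0)"

fun T_bar :: "intersection \<Rightarrow> state \<Rightarrow> schedule \<Rightarrow> nat \<Rightarrow> nat \<Rightarrow> real" where
  "T_bar S (x, v) T i j =
     (let i' = first_of S x j in
      if (i, j) \<in> first_ops S x then T i j
      else if x j < \<alpha>min S j then T i' j + min_time S j (\<alpha>min S j) (vmax S j) (\<alpha> S i j)
      else T i' j - R_bar S (x, v) i' j + min_time S j (x j) (v j) (\<alpha> S i j))"

fun P_bar :: "intersection \<Rightarrow> state \<Rightarrow> schedule \<Rightarrow> nat \<Rightarrow> nat \<Rightarrow> real" where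
  "P_bar S (x, v) T i j =
     (let i' = first_of S x j in
      if x j < \<alpha>min S j then
        (if (i, j) \<in> first_ops S x then T i j + min_time S j (\<alpha> S i j) (vmin S j) (\<beta> S i j)
         else T i' j + min_time S j (\<alpha>min S j) (vmin S j) (\<beta> S i j))
      else
        (if (i, j) \<in> first_ops S x then T i j - R_bar S (x, v) i j + min_time S j (x j) (v j) (\<beta> S i j)
         else T i' j - R_bar S (x, v) i' j + min_time S j (x j) (v j) (\<beta> S i j)))"

fun schedule_domain :: "intersection \<Rightarrow> state \<Rightarrow> schedule set" where
  "schedule_domain S (x, v) =
     {T. \<forall>(i, j)\<in>first_ops S x.
           if x j < \<alpha> S i j then T i j \<in> hit_times S j (x j) (v j) (\<alpha> S i j) else T i j = 0}"

text \<open>The pair consists of a schedule and the binary variables; \<open>M\<close> is the big-M constant.\<close>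

definition feasible ::
  "intersection \<Rightarrow> real \<Rightarrow> state \<Rightarrow> (schedule \<times> (nat \<Rightarrow> nat \<Rightarrow> nat \<Rightarrow> nat)) set"
where
  "feasible S M z =
     {(T, k). T \<in> schedule_domain S z \<and>
        (\<forall>(i, j)\<in>first_ops S (fst z). R_bar S z i j \<le> T i j) \<and>
        (\<forall>(i, j, j')\<in>arcs S (fst z).
           k i j j' \<in> {0, 1} \<and> k i j' j \<in> {0, 1} \<and>
           P_bar S z T i j \<le> T_bar S z T i j' + M * (1 - real (k i j j')) \<and>
           P_bar S z T i j' \<le> T_bar S z T i j + M * (1 - real (k i j' j)) \<and>
           k i j j' + k i j' j = 1)}"

definition objective :: "intersection \<Rightarrow> state \<Rightarrow> schedule \<Rightarrow> real" where
  "objective S z T = Max (insert 0 ((\<lambda>(i, j). T i j - D_bar S z i j) ` first_ops S (fst z)))"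

definition s_U :: "intersection \<Rightarrow> real \<Rightarrow> state \<Rightarrow> ereal" where
  "s_U S M z = (INF (T, k)\<in>feasible S M z. ereal (objective S z T))"

definition optimal_schedules :: "intersection \<Rightarrow> real \<Rightarrow> state \<Rightarrow> schedule set" where
  "optimal_schedules S M z =
     {T. \<exists>k. (T, k) \<in> feasible S M z \<and> ereal (objective S z T) = s_U S M z}"


section \<open>Supervisor\<close>

text \<open>
  The algorithm leaves open which optimal schedule and which signal of the generator's set are
  used.  These choices are arbitrary selection functions; they return \<open>None\<close> exactly if there
  is nothing to choose from.
\<close>

definition selects :: "'a set \<Rightarrow> 'a option \<Rightarrow> bool" where
  "selects A r \<longleftrightarrow> (case r of None \<Rightarrow> A = {} | Some a \<Rightarrow> a \<in> A)"

definition approx_verification ::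
  "intersection \<Rightarrow> real \<Rightarrow> (state \<Rightarrow> ereal \<times> schedule option) \<Rightarrow> bool"
where
  "approx_verification S M AV \<longleftrightarrow>
     (\<forall>z. fst (AV z) = s_U S M z \<and> selects (optimal_schedules S M z) (snd (AV z)))"

text \<open>
  A vehicle that has already passed \<open>\<alpha> S i j\<close>, the entry of its first operation, has scheduled
  time 0 by convention and cannot be at \<open>\<alpha> S i j\<close> at that time; for such a vehicle only the
  maximal input is required.
\<close>

fun generated_signals :: "intersection \<Rightarrow> state \<Rightarrow> schedule \<Rightarrow> signals set" where
  "generated_signals S (y, w) T =
     {u. (\<forall>j\<in>vehicles S. u j \<in> sig_space S j) \<and>
         (\<forall>(i, j)\<in>first_ops S y.
            (y j < \<alpha> S i j \<longrightarrow> pos S j (T i j) (u j) (y j) (w j) = \<alpha> S i j) \<and>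
            (\<forall>t\<ge>T i j. u j t = umax S j))}"

definition input_generator ::
  "intersection \<Rightarrow> (state \<Rightarrow> schedule \<Rightarrow> signals option) \<Rightarrow> bool"
where
  "input_generator S \<sigma> \<longleftrightarrow> (\<forall>z T. selects (generated_signals S z T) (\<sigma> z T))"

text \<open>
  Given the current state, the stored safe signal (if any) and the desired input, the supervisor
  yields the signal to be applied and the safe signal to be stored, or \<open>None\<close> if one of the
  objects it needs does not exist.  Signals on \<open>[0, \<tau>)\<close> are represented by signals on
  \<open>[0, \<infinity>)\<close>; they are only ever applied for a duration \<open>\<tau>\<close>.
\<close>

definition supervisor ::
  "intersection \<Rightarrow> real \<Rightarrow> (state \<Rightarrow> ereal \<times> schedule option) \<Rightarrow>
   (state \<Rightarrow> schedule \<Rightarrow> signals option) \<Rightarrow>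
   state \<Rightarrow> signals option \<Rightarrow> input \<Rightarrow> (signals \<times> signals) option"
where
  "supervisor S \<tau> AV \<sigma> z stored ud =
     (let u_d = (\<lambda>j t. ud j);
          z_d = evolve S \<tau> u_d z;
          (s, T1) = AV z_d
      in if s = 0
         then do {
           T \<leftarrow> T1;
           safe \<leftarrow> \<sigma> z_d T;
           Some (u_d, safe)
         }
         else do {
           u_safe \<leftarrow> stored;
           let z_safe = evolve S \<tau> u_safe z;
           T2 \<leftarrow> snd (AV z_safe);
           safe \<leftarrow> \<sigma> z_safe T2;
           Some (u_safe, safe)
         })"

text \<open>State and stored safe signal at time \<open>k * \<tau>\<close>; \<open>None\<close> if the supervisor has failed before.\<close>

primrec closed_loop ::
  "intersection \<Rightarrow> real \<Rightarrow> (state \<Rightarrow> ereal \<times> schedule option) \<Rightarrow>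
   (state \<Rightarrow> schedule \<Rightarrow> signals option) \<Rightarrow>
   state \<Rightarrow> (nat \<Rightarrow> input) \<Rightarrow> nat \<Rightarrow> (state \<times> signals option) option"
where
  "closed_loop S \<tau> AV \<sigma> z0 ud 0 = Some (z0, None)"
| "closed_loop S \<tau> AV \<sigma> z0 ud (Suc k) =
     do {
       (z, stored) \<leftarrow> closed_loop S \<tau> AV \<sigma> z0 ud k;
       (u, safe) \<leftarrow> supervisor S \<tau> AV \<sigma> z stored (ud k);
       Some (evolve S \<tau> u z, Some safe)
     }"

end

theory Submission
  imports Defs
begin

text \<open>
  A state is \<^emph>\<open>recoverable\<close> if the upper bound problem has value 0 there.  The proof shows that
  recoverability is never lost when a generated signal is applied: it is the invariant that every
  stored safe signal carries the current state to a recoverable one.  If the desired input leads to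
  a recoverable state, the supervisor applies it; otherwise the stored signal leads to such a state.
  Either way a new schedule and a new signal have to be produced from a recoverable state, and the
  new signal has to lead to a recoverable state again.  Three facts make this possible.

  First, a recoverable state has an optimal schedule, that is, the infimum 0 is attained
  (\<open>optimal_schedules_nonempty\<close>).  The times at which a vehicle can reach a given point form the
  interval between its arrival times under maximal and minimal input, because the signal space is
  connected and the position depends continuously on the signal (\<open>hit_times_interval\<close>).  Hence, up
  to irrelevant entries, the feasible pairs of a schedule and binary variables form a compact set, on
  which the continuous objective attains its infimum.

  Second, a signal is generated for every schedule in the domain of the upper bound problem
  (\<open>generated_signals_nonempty\<close>): a signal that reaches the first conflict area at its scheduled
  time may be replaced by the maximal input from that time on.

  Third, let \<open>T\<close> be a schedule of delay 0 and let a signal generated for it act for a time \<open>s\<close>.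
  Its planned times are pessimistic: \<open>T_bar\<close> is a lower bound on the entry
  times (\<open>no_entry_before_T_bar\<close>), and by the time \<open>P_bar\<close> the vehicle has left the conflict area
  (\<open>exit_by_P_bar\<close>).  At the new state one may therefore plan with the schedule \<open>advance s z' T\<close>.
  For every conflict area that is still to be left, the new bounds, counted from time \<open>s\<close>, are at
  least as tight as the old ones (\<open>T_bar_advance\<close>, \<open>P_bar_advance\<close>).  So every inequality
  \<open>P_bar \<le> T_bar + M * (1 - k)\<close> persists with the same binary variables
  (\<open>feasible_advance\<close>), and the advanced schedule again has delay 0 (\<open>objective_advance\<close>).
\<close>

section \<open>Integrals, continuity and compactness\<close>

lemma has_integral_shifted_tail:
  fixes f :: "real \<Rightarrow> real"
  assumes "(f has_integral i) {0..s}" "(f has_integral k) {0..t + s}" "0 \<le> s" "0 \<le> t"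
  shows "((\<lambda>r. f (r + s)) has_integral k - i) {0..t}"
proof -
  have "f integrable_on {s..t + s}"
    by (rule integrable_on_subinterval[OF has_integral_integrable[OF assms(2)]]) (use assms(3) in auto)
  then obtain l where l: "(f has_integral l) {s..t + s}" by blast
  have "(f has_integral i + l) {0..t + s}"
    using has_integral_combine[OF _ _ assms(1) l] assms(3,4) by auto
  from has_integral_unique[OF assms(2) this] have "l = k - i" by simp
  then show ?thesis using has_integral_shift_real_ivl[OF l, of s] by simp
qed

lemma has_integral_splice:
  fixes f g :: "real \<Rightarrow> real"
  assumes "(f has_integral i) {0..s}" "(g has_integral k) {0..t - s}" "0 \<le> s" "s \<le> t"
  shows "((\<lambda>r. if r < s then f r else g (r - s)) has_integral i + k) {0..t}"
proof (rule has_integral_combine[OF assms(3,4)])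
  show "((\<lambda>r. if r < s then f r else g (r - s)) has_integral i) {0..s}"
    by (rule has_integral_spike_finite[OF _ _ assms(1), of "{s}"]) auto
  have "((\<lambda>r. g (r - s)) has_integral k) {s..t}"
    using has_integral_shift_real_ivl[OF assms(2), of "- s"] by simp
  then show "((\<lambda>r. if r < s then f r else g (r - s)) has_integral k) {s..t}"
    by (rule has_integral_eq[rotated]) simp
qed

text \<open>
  This is Tychonoff's theorem, applied in \<open>optimal_schedules_nonempty\<close> to each argument of a
  curried function in turn.
\<close>

lemma compact_functions:
  fixes K :: "'i \<Rightarrow> 'b::topological_space set"
  assumes "\<And>i. compact (K i)"
  shows "compact {f. \<forall>i. f i \<in> K i}"
proof -
  have "compactin (product_topology (\<lambda>_. euclidean) UNIV) (PiE UNIV K)"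
    unfolding compactin_PiE using assms by simp
  moreover have "PiE UNIV K = {f. \<forall>i. f i \<in> K i}" by auto
  ultimately show ?thesis by (simp add: euclidean_product_topology)
qed

lemma continuous_on_Max_insert:
  fixes g :: "'b \<Rightarrow> 'a::topological_space \<Rightarrow> real"
  assumes "finite I" "\<And>i. i \<in> I \<Longrightarrow> continuous_on A (g i)"
  shows "continuous_on A (\<lambda>p. Max (insert c ((\<lambda>i. g i p) ` I)))"
  using assms
proof (induction I rule: finite_induct)
  case empty
  then show ?case by simp
next
  case (insert i I)
  have "Max (insert c ((\<lambda>i. g i p) ` insert i I)) = max (g i p) (Max (insert c ((\<lambda>i. g i p) ` I)))"
    for p
  proof -
    have "insert c ((\<lambda>i. g i p) ` insert i I) = insert (g i p) (insert c ((\<lambda>i. g i p) ` I))" by auto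
    then show ?thesis using insert.hyps(1) by (simp only:) (rule Max_insert, simp_all)
  qed
  then show ?case using insert by (auto intro!: continuous_intros)
qed

locale controlled_intersection =
  fixes S :: intersection
  assumes model: "intersection_model S"
    and continuous: "continuous_inputs S"
    and monotone: "monotone_flow S"
begin

section \<open>The flow of a single vehicle\<close>

text \<open>
  Positions and speeds are only meaningful for indices of actual vehicles, so the index is part of
  the predicate.
\<close>

definition vehicle_state :: "nat \<Rightarrow> real \<Rightarrow> real \<Rightarrow> bool" where
  "vehicle_state j a b \<longleftrightarrow> j \<in> vehicles S \<and> a \<in> X S j \<and> b \<in> V S j"

lemma speed_bounds:
  assumes "j \<in> vehicles S"
  shows "0 < vmin S j" "vmin S j \<le> vmax S j" "umin S j \<le> umax S j"
  using model assms unfolding intersection_model_def by auto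

lemma extreme_speeds:
  assumes "vehicle_state j a b"
  shows "vehicle_state j a (vmin S j)" "vehicle_state j a (vmax S j)"
    and "vmin S j \<le> b" "b \<le> vmax S j"
  using assms speed_bounds[of j] unfolding vehicle_state_def V_def by auto

lemma signal_bounds:
  assumes "j \<in> vehicles S" "u \<in> sig_space S j" "0 \<le> t"
  shows "umin S j \<le> u t" "u t \<le> umax S j"
  using model assms unfolding intersection_model_def admissible_signals_def by auto

lemma constant_signal:
  assumes "j \<in> vehicles S" "umin S j \<le> c" "c \<le> umax S j"
  shows "(\<lambda>t. c) \<in> sig_space S j"
  using model assms unfolding intersection_model_def admissible_signals_def by auto

lemma extreme_signals:
  assumes "j \<in> vehicles S"
  shows "(\<lambda>t. umin S j) \<in> sig_space S j" "(\<lambda>t. umax S j) \<in> sig_space S j"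
  using constant_signal speed_bounds(3) assms by auto

lemma restarted_signal:
  assumes "j \<in> vehicles S" "u \<in> sig_space S j" "0 \<le> s"
  shows "(\<lambda>t. u (t + s)) \<in> sig_space S j"
  using model assms unfolding intersection_model_def admissible_signals_def by auto

lemma spliced_signal:
  assumes "j \<in> vehicles S" "u \<in> sig_space S j" "w \<in> sig_space S j" "0 \<le> s"
  shows "(\<lambda>t. if t < s then u t else w (t - s)) \<in> sig_space S j"
  using model assms unfolding intersection_model_def admissible_signals_def by auto

lemma flow_trajectory:
  assumes "vehicle_state j a b" "u \<in> sig_space S j"
  shows "trajectory S j u a b (\<lambda>t. pos S j t u a b) (\<lambda>t. vel S j t u a b)"
  using model assms
  unfolding intersection_model_def well_posed_flow_def vehicle_state_def by blast

lemma trajectory_unique: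
  assumes "vehicle_state j a b" "u \<in> sig_space S j" "trajectory S j u a b p v" "0 \<le> t"
  shows "p t = pos S j t u a b" "v t = vel S j t u a b"
  using model assms
  unfolding intersection_model_def well_posed_flow_def vehicle_state_def by blast+

lemma flow_state:
  assumes "vehicle_state j a b" "u \<in> sig_space S j" "0 \<le> t"
  shows "vehicle_state j (pos S j t u a b) (vel S j t u a b)"
  using flow_trajectory[OF assms(1,2)] assms unfolding trajectory_def vehicle_state_def by auto

lemma flow_integral:
  assumes "vehicle_state j a b" "u \<in> sig_space S j" "0 \<le> t"
  shows "((\<lambda>s. vel S j s u a b) has_integral pos S j t u a b - a) {0..t}"
    and "((\<lambda>s. acc S j (pos S j s u a b) (vel S j s u a b) (u s))
           has_integral vel S j t u a b - b) {0..t}"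
  using flow_trajectory[OF assms(1,2)] assms(3) unfolding trajectory_def by auto

lemma flow_start:
  assumes "vehicle_state j a b" "u \<in> sig_space S j"
  shows "pos S j 0 u a b = a" "vel S j 0 u a b = b"
proof -
  have "c = 0" if "(f has_integral c) {0..0}" for f :: "real \<Rightarrow> real" and c
    using has_integral_unique[OF that] has_integral_refl(2)[of f 0] by simp
  from this[OF flow_integral(1)[OF assms order_refl]] this[OF flow_integral(2)[OF assms order_refl]]
  show "pos S j 0 u a b = a" "vel S j 0 u a b = b" by simp_all
qed

text \<open>
  Signals are functions on all reals, but only their values at nonnegative times enter the dynamics.
  Two signals that agree there have the same trajectories, by uniqueness of solutions.
\<close>

lemma flow_cong:
  assumes "vehicle_state j a b" "u \<in> sig_space S j" "w \<in> sig_space S j"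
    and eq: "\<And>s. 0 \<le> s \<Longrightarrow> u s = w s" and "0 \<le> t"
  shows "pos S j t u a b = pos S j t w a b" "vel S j t u a b = vel S j t w a b"
proof -
  have "trajectory S j w a b (\<lambda>t. pos S j t u a b) (\<lambda>t. vel S j t u a b)"
    unfolding trajectory_def
  proof (intro allI impI conjI)
    fix t :: real assume t: "0 \<le> t"
    show "pos S j t u a b \<in> X S j" "vel S j t u a b \<in> V S j"
      using flow_state[OF assms(1,2) t] unfolding vehicle_state_def by auto
    show "((\<lambda>s. vel S j s u a b) has_integral pos S j t u a b - a) {0..t}"
      by (rule flow_integral[OF assms(1,2) t])
    show "((\<lambda>s. acc S j (pos S j s u a b) (vel S j s u a b) (w s))
           has_integral vel S j t u a b - b) {0..t}"
      by (rule has_integral_eq[OF _ flow_integral(2)[OF assms(1,2) t]]) (simp add: eq)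
  qed
  from trajectory_unique[OF assms(1,3) this \<open>0 \<le> t\<close>]
  show "pos S j t u a b = pos S j t w a b" "vel S j t u a b = vel S j t w a b" by auto
qed

text \<open>
  The semigroup property of the flow: the shifted trajectory solves the shifted equation, so it is
  the flow of the restarted signal.
\<close>

lemma flow_restart:
  assumes st: "vehicle_state j a b" and u: "u \<in> sig_space S j" and s: "0 \<le> s" and t: "0 \<le> t"
  shows "pos S j t (\<lambda>r. u (r + s)) (pos S j s u a b) (vel S j s u a b) = pos S j (t + s) u a b"
    and "vel S j t (\<lambda>r. u (r + s)) (pos S j s u a b) (vel S j s u a b) = vel S j (t + s) u a b"
proof -
  have j: "j \<in> vehicles S" using st unfolding vehicle_state_def by auto
  have "trajectory S j (\<lambda>r. u (r + s)) (pos S j s u a b) (vel S j s u a b)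
          (\<lambda>t. pos S j (t + s) u a b) (\<lambda>t. vel S j (t + s) u a b)"
    unfolding trajectory_def
  proof (intro allI impI conjI)
    fix t :: real assume t: "0 \<le> t"
    then have ts: "0 \<le> t + s" using s by auto
    show "pos S j (t + s) u a b \<in> X S j" "vel S j (t + s) u a b \<in> V S j"
      using flow_state[OF st u ts] unfolding vehicle_state_def by auto
    show "((\<lambda>r. vel S j (r + s) u a b) has_integral pos S j (t + s) u a b - pos S j s u a b) {0..t}"
      using has_integral_shifted_tail[OF flow_integral(1)[OF st u s] flow_integral(1)[OF st u ts] s t]
      by simp
    show "((\<lambda>r. acc S j (pos S j (r + s) u a b) (vel S j (r + s) u a b) (u (r + s)))
           has_integral vel S j (t + s) u a b - vel S j s u a b) {0..t}"
      using has_integral_shifted_tail[OF flow_integral(2)[OF st u s] flow_integral(2)[OF st u ts] s t]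
      by simp
  qed
  from trajectory_unique[OF flow_state[OF st u s] restarted_signal[OF j u s] this t]
  show "pos S j t (\<lambda>r. u (r + s)) (pos S j s u a b) (vel S j s u a b) = pos S j (t + s) u a b"
    and "vel S j t (\<lambda>r. u (r + s)) (pos S j s u a b) (vel S j s u a b) = vel S j (t + s) u a b"
    by auto
qed

text \<open>
  Concatenating the two trajectories gives a solution for the spliced signal.  The first conclusion
  also expresses causality: what the signal does after time \<open>s\<close> does not influence the position
  up to time \<open>s\<close>.
\<close>

lemma flow_splice:
  fixes s :: real
  assumes st: "vehicle_state j a b" and u: "u \<in> sig_space S j" and w: "w \<in> sig_space S j"
    and s: "0 \<le> s"
  defines "us \<equiv> \<lambda>t. if t < s then u t else w (t - s)"
  shows "0 \<le> t \<Longrightarrow> t \<le> s \<Longrightarrow> pos S j t us a b = pos S j t u a b"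
    and "s \<le> t \<Longrightarrow> pos S j t us a b = pos S j (t - s) w (pos S j s u a b) (vel S j s u a b)"
proof -
  define a' b' where "a' = pos S j s u a b" and "b' = vel S j s u a b"
  define p where "p t = (if t < s then pos S j t u a b else pos S j (t - s) w a' b')" for t
  define v where "v t = (if t < s then vel S j t u a b else vel S j (t - s) w a' b')" for t
  have j: "j \<in> vehicles S" using st unfolding vehicle_state_def by auto
  have st': "vehicle_state j a' b'" unfolding a'_def b'_def by (rule flow_state[OF st u s])
  have us: "us \<in> sig_space S j" unfolding us_def by (rule spliced_signal[OF j u w s])
  have tr: "trajectory S j us a b p v"
    unfolding trajectory_def
  proof (intro allI impI conjI)
    fix t :: real assume t: "0 \<le> t"
    show "p t \<in> X S j" "v t \<in> V S j"
      using flow_state[OF st u t] flow_state[OF st' w, of "t - s"]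
      unfolding vehicle_state_def p_def v_def by auto
    show "(v has_integral p t - a) {0..t}"
    proof (cases "t < s")
      case True
      then have "(v has_integral pos S j t u a b - a) {0..t}"
        by (intro has_integral_eq[OF _ flow_integral(1)[OF st u t]]) (auto simp: v_def)
      with True show ?thesis by (simp add: p_def)
    next
      case False
      have "((\<lambda>r. if r < s then vel S j r u a b else vel S j (r - s) w a' b') has_integral
             (pos S j s u a b - a) + (pos S j (t - s) w a' b' - a')) {0..t}"
        using False by (intro has_integral_splice flow_integral st u w st' s) auto
      with False show ?thesis by (simp add: p_def a'_def v_def[abs_def])
    qed
    show "((\<lambda>r. acc S j (p r) (v r) (us r)) has_integral v t - b) {0..t}"
    proof (cases "t < s")
      case True
      then have "((\<lambda>r. acc S j (p r) (v r) (us r)) has_integral vel S j t u a b - b) {0..t}"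
        by (intro has_integral_eq[OF _ flow_integral(2)[OF st u t]]) (auto simp: v_def p_def us_def)
      with True show ?thesis by (simp add: v_def)
    next
      case False
      have "((\<lambda>r. if r < s then acc S j (pos S j r u a b) (vel S j r u a b) (u r)
               else acc S j (pos S j (r - s) w a' b') (vel S j (r - s) w a' b') (w (r - s)))
             has_integral
             (vel S j s u a b - b) + (vel S j (t - s) w a' b' - b')) {0..t}"
        using False
        by (intro has_integral_splice[of "\<lambda>r. acc S j (pos S j r u a b) (vel S j r u a b) (u r)" _ _
              "\<lambda>r. acc S j (pos S j r w a' b') (vel S j r w a' b') (w r)"]
              flow_integral st u w st' s) auto
      moreover have "(\<lambda>r. acc S j (p r) (v r) (us r)) =
            (\<lambda>r. if r < s then acc S j (pos S j r u a b) (vel S j r u a b) (u r)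
               else acc S j (pos S j (r - s) w a' b') (vel S j (r - s) w a' b') (w (r - s)))"
        by (auto simp: fun_eq_iff p_def v_def us_def)
      ultimately show ?thesis using False by (simp add: v_def b'_def)
    qed
  qed
  note uniq = trajectory_unique[OF st us tr]
  show "pos S j t us a b = pos S j (t - s) w a' b'" if "s \<le> t"
    using uniq(1)[of t] that s by (simp add: p_def)
  show "pos S j t us a b = pos S j t u a b" if "0 \<le> t" "t \<le> s"
    using uniq(1)[of t] that s flow_start[OF st' w]
    by (cases "t = s") (auto simp: p_def a'_def)
qed

text \<open>
  The positive minimal speed makes the position strictly increasing and unbounded in time, so that
  every point ahead is hit exactly once and statements about hitting times can be read off from
  positions.
\<close>

lemma pos_gap:
  assumes st: "vehicle_state j a b" and u: "u \<in> sig_space S j" and "0 \<le> s" "s \<le> t"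
  shows "pos S j s u a b + vmin S j * (t - s) \<le> pos S j t u a b"
proof -
  have *: "a + vmin S j * t \<le> pos S j t u a b"
    if "vehicle_state j a b" "u \<in> sig_space S j" "0 \<le> t" for a b u t
  proof -
    have "((\<lambda>_. vmin S j) has_integral vmin S j * t) {0..t}"
      using has_integral_const_real[of "vmin S j" 0 t] that(3) by (simp add: mult.commute)
    then have "vmin S j * t \<le> pos S j t u a b - a"
      by (rule has_integral_le[OF _ flow_integral(1)[OF that]])
        (use flow_state[OF that(1,2)] extreme_speeds(3) in auto)
    then show ?thesis by simp
  qed
  have j: "j \<in> vehicles S" using st unfolding vehicle_state_def by auto
  show ?thesis
    using *[OF flow_state[OF st u \<open>0 \<le> s\<close>] restarted_signal[OF j u \<open>0 \<le> s\<close>], of "t - s"]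
      flow_restart(1)[OF st u \<open>0 \<le> s\<close>, of "t - s"] assms(4) by simp
qed

lemma pos_le_iff:
  assumes "vehicle_state j a b" "u \<in> sig_space S j" "0 \<le> s" "0 \<le> t"
  shows "pos S j s u a b \<le> pos S j t u a b \<longleftrightarrow> s \<le> t"
proof -
  have v: "0 < vmin S j" using speed_bounds assms unfolding vehicle_state_def by auto
  have "pos S j r u a b < pos S j r' u a b" if "0 \<le> r" "r < r'" for r r'
  proof -
    have "0 < vmin S j * (r' - r)" using v that by simp
    then show ?thesis using pos_gap[OF assms(1,2), of r r'] that by linarith
  qed
  from this[of s t] this[of t s] show ?thesis using assms(3,4)
    by (cases s t rule: linorder_cases) auto
qed

lemma pos_ge_start:
  assumes "vehicle_state j a b" "u \<in> sig_space S j" "0 \<le> t"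
  shows "a \<le> pos S j t u a b"
  using pos_le_iff[OF assms(1,2), of 0 t] flow_start[OF assms(1,2)] assms(3) by auto

lemma pos_mono:
  assumes "vehicle_state j a b" "vehicle_state j a b'" "u \<in> sig_space S j" "w \<in> sig_space S j"
    and "\<And>s. 0 \<le> s \<Longrightarrow> u s \<le> w s" "b \<le> b'" "0 \<le> t"
  shows "pos S j t u a b \<le> pos S j t w a b'"
proof -
  have j: "j \<in> vehicles S" "a \<in> X S j" "b \<in> V S j" "b' \<in> V S j"
    using assms unfolding vehicle_state_def by auto
  show ?thesis
    by (rule monotone[unfolded monotone_flow_def, rule_format, OF j(1) assms(3,4) j(2,2,3,4)])
      (simp_all add: assms)
qed

lemma flow_continuous:
  assumes "vehicle_state j a b" "u \<in> sig_space S j" "0 \<le> r"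
  shows "continuous_on {0..r} (\<lambda>t. pos S j t u a b)" "continuous_on {0..r} (\<lambda>t. vel S j t u a b)"
proof -
  have *: "continuous_on {0..r} p"
    if "\<And>t. 0 \<le> t \<Longrightarrow> (f has_integral p t - c) {0..t}" for p f :: "real \<Rightarrow> real" and c
  proof -
    have "continuous_on {0..r} (\<lambda>t. c + integral {0..t} f)"
      using that[OF assms(3)] by (intro continuous_intros indefinite_integral_continuous_1) blast
    moreover have "c + integral {0..t} f = p t" if "t \<in> {0..r}" for t
      using integral_unique[OF \<open>\<And>t. 0 \<le> t \<Longrightarrow> (f has_integral p t - c) {0..t}\<close>, of t] that by simp
    ultimately show ?thesis by (rule continuous_on_eq)
  qed
  show "continuous_on {0..r} (\<lambda>t. pos S j t u a b)" "continuous_on {0..r} (\<lambda>t. vel S j t u a b)"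
    using *[OF flow_integral(1)[OF assms(1,2)]] *[OF flow_integral(2)[OF assms(1,2)]] by blast+
qed

lemma pos_derivative:
  assumes "vehicle_state j a b" "u \<in> sig_space S j" "0 < t"
  shows "((\<lambda>t. pos S j t u a b) has_real_derivative vel S j t u a b) (at t)"
proof -
  have "((\<lambda>s. integral {0..s} (\<lambda>r. vel S j r u a b)) has_real_derivative vel S j t u a b)
          (at t within {0..t + 1})"
    using assms(3) by (intro integral_has_real_derivative flow_continuous assms(1,2)) auto
  moreover have "at t within {0..t + 1} = at t" using assms(3) by (intro at_within_Icc_at) auto
  ultimately have
    "((\<lambda>s. a + integral {0..s} (\<lambda>r. vel S j r u a b)) has_real_derivative vel S j t u a b) (at t)"
    by (auto intro!: derivative_eq_intros)
  moreover have "eventually (\<lambda>s. a + integral {0..s} (\<lambda>r. vel S j r u a b) = pos S j s u a b) (nhds t)"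
    using eventually_nhds_in_open[of "{0<..}" t] assms(3)
    by (auto elim!: eventually_mono dest!: less_imp_le
        simp: integral_unique[OF flow_integral(1)[OF assms(1,2)]])
  ultimately show ?thesis by (subst (asm) DERIV_cong_ev[OF refl _ refl])
qed

section \<open>Hitting times\<close>

lemma vehicle_state_vehicle: "vehicle_state j a b \<Longrightarrow> j \<in> vehicles S"
  unfolding vehicle_state_def by simp

lemma pos_hits:
  assumes st: "vehicle_state j a b" and u: "u \<in> sig_space S j" and c: "a \<le> c"
  obtains t where "0 \<le> t" "pos S j t u a b = c"
proof -
  \<comment> \<open>At minimal speed, the point \<open>c\<close> would be reached at time \<open>r\<close>.\<close>
  define r where "r = (c - a) / vmin S j"
  have v: "0 < vmin S j" by (rule speed_bounds(1)[OF vehicle_state_vehicle[OF st]])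
  have r: "0 \<le> r" "vmin S j * r = c - a" using v c by (auto simp: r_def)
  have "\<exists>t\<ge>0. t \<le> r \<and> pos S j t u a b = c"
  proof (rule IVT')
    show "pos S j 0 u a b \<le> c" using flow_start[OF st u] c by simp
    show "c \<le> pos S j r u a b" using pos_gap[OF st u order_refl r(1)] flow_start[OF st u] r by simp
  qed (use r flow_continuous[OF st u] in auto)
  then show thesis using that by blast
qed

lemma hit_times_bounds:
  assumes st: "vehicle_state j a b" and u: "u \<in> sig_space S j"
    and lo: "0 \<le> r" "pos S j r (\<lambda>_. umax S j) a b = c"
    and hi: "0 \<le> s" "pos S j s (\<lambda>_. umin S j) a b = c"
    and t: "0 \<le> t" "pos S j t u a b = c"
  shows "r \<le> t" "t \<le> s"
proof -
  note j = vehicle_state_vehicle[OF st]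
  note ext = extreme_signals[OF j]
  have "c \<le> pos S j t (\<lambda>_. umax S j) a b"
    using pos_mono[OF st st u ext(2), of t] signal_bounds[OF j u] t by auto
  then show "r \<le> t" using pos_le_iff[OF st ext(2) lo(1) t(1)] lo by simp
  have "pos S j t (\<lambda>_. umin S j) a b \<le> c"
    using pos_mono[OF st st ext(1) u, of t] signal_bounds[OF j u] t by auto
  then show "t \<le> s" using pos_le_iff[OF st ext(1) t(1) hi(1)] hi by simp
qed

text \<open>
  By monotonicity the maximal input arrives first and the minimal input last.  At any time in between,
  the positions reached by all signals form a connected set that contains points on both sides of
  \<open>c\<close>, hence \<open>c\<close> itself.
\<close>

lemma hit_times_interval:
  assumes st: "vehicle_state j a b"
    and lo: "0 \<le> r" "pos S j r (\<lambda>_. umax S j) a b = c"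
    and hi: "0 \<le> s" "pos S j s (\<lambda>_. umin S j) a b = c"
  shows "hit_times S j a b c = {r..s}"
proof (intro equalityI subsetI)
  fix t assume "t \<in> hit_times S j a b c"
  then obtain u where "0 \<le> t" "u \<in> sig_space S j" "pos S j t u a b = c"
    unfolding hit_times_def by auto
  then show "t \<in> {r..s}" using hit_times_bounds[OF st _ lo hi] by auto
next
  fix t assume "t \<in> {r..s}"
  then have t: "0 \<le> t" "r \<le> t" "t \<le> s" using lo by auto
  note j = vehicle_state_vehicle[OF st]
  note ext = extreme_signals[OF j]
  let ?P = "(\<lambda>u. pos S j t u a b) ` sig_space S j"
  have "connected_space (sig_top S j)"
    using continuous j unfolding continuous_inputs_def
    by (blast intro: path_connected_imp_connected_space)
  moreover have "continuous_map (sig_top S j) euclideanreal (\<lambda>u. pos S j t u a b)"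
    using continuous st t(1) unfolding continuous_inputs_def vehicle_state_def by blast
  \<comment> \<open>The positions that can be reached at time \<open>t\<close> form an interval.\<close>
  ultimately have "connectedin euclideanreal ?P"
    unfolding sig_space_def connectedin_topspace[symmetric]
    by (rule connectedin_continuous_map_image[rotated])
  then have conn: "connected ?P" by simp
  have "pos S j t (\<lambda>_. umin S j) a b \<le> c" "c \<le> pos S j t (\<lambda>_. umax S j) a b"
    using pos_le_iff[OF st ext(1) t(1) hi(1)] pos_le_iff[OF st ext(2) lo(1) t(1)] lo hi t by auto
  then have "c \<in> ?P"
    using connectedD_interval[OF conn imageI[OF ext(1)] imageI[OF ext(2)]] by blast
  then show "t \<in> hit_times S j a b c" unfolding hit_times_def using t by auto
qed

lemma min_time_attained:
  assumes st: "vehicle_state j a b" and c: "a \<le> c"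
  shows "0 \<le> min_time S j a b c" "pos S j (min_time S j a b c) (\<lambda>_. umax S j) a b = c"
    and "hit_times S j a b c = {min_time S j a b c..max_time S j a b c}"
    and "hit_times S j a b c \<noteq> {}"
proof -
  note ext = extreme_signals[OF vehicle_state_vehicle[OF st]]
  obtain r where r: "0 \<le> r" "pos S j r (\<lambda>_. umax S j) a b = c" by (rule pos_hits[OF st ext(2) c])
  obtain s where s: "0 \<le> s" "pos S j s (\<lambda>_. umin S j) a b = c" by (rule pos_hits[OF st ext(1) c])
  have rs: "r \<le> s" by (rule hit_times_bounds(1)[OF st ext(1) r s s])
  note eq = hit_times_interval[OF st r s]
  have "min_time S j a b c = r" "max_time S j a b c = s"
    unfolding min_time_def max_time_def eq using rs by auto
  then show "0 \<le> min_time S j a b c" "pos S j (min_time S j a b c) (\<lambda>_. umax S j) a b = c"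
    and "hit_times S j a b c = {min_time S j a b c..max_time S j a b c}"
    and "hit_times S j a b c \<noteq> {}"
    using r eq rs by auto
qed

lemma min_time_hits:
  assumes "vehicle_state j a b" "a \<le> c"
  shows "min_time S j a b c \<in> hit_times S j a b c"
  using min_time_attained(3,4)[OF assms] by auto

lemma min_time_le:
  assumes st: "vehicle_state j a b" and u: "u \<in> sig_space S j" and "0 \<le> t" "a \<le> c"
    and "c \<le> pos S j t u a b"
  shows "min_time S j a b c \<le> t"
proof -
  obtain s where s: "0 \<le> s" "pos S j s u a b = c" by (rule pos_hits[OF st u \<open>a \<le> c\<close>])
  then have "s \<le> t" using pos_le_iff[OF st u s(1) \<open>0 \<le> t\<close>] assms(5) by simp
  moreover have "s \<in> hit_times S j a b c" using s u unfolding hit_times_def by auto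
  ultimately show ?thesis using min_time_attained(3)[OF st \<open>a \<le> c\<close>] by auto
qed

text \<open>
  Starting faster under the maximal input never delays the arrival.  This is why planning with extreme
  speeds at the entry of the intersection gives bounds for the actual motion.
\<close>

lemma min_time_antimono_speed:
  assumes st: "vehicle_state j a b" "vehicle_state j a b'" and "b \<le> b'" "a \<le> c"
  shows "min_time S j a b' c \<le> min_time S j a b c"
proof -
  note ext = extreme_signals(2)[OF vehicle_state_vehicle[OF st(1)]]
  note m = min_time_attained(1,2)[OF st(1) \<open>a \<le> c\<close>]
  show ?thesis
    using pos_mono[OF st ext ext order_refl \<open>b \<le> b'\<close> m(1)] m
    by (intro min_time_le[OF st(2) ext _ \<open>a \<le> c\<close>]) auto
qed

text \<open>
  Following \<open>u\<close> up to time \<open>s\<close> and the fastest input afterwards is one way to reach \<open>c\<close>.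
\<close>

lemma min_time_dynamic_programming:
  assumes st: "vehicle_state j a b" and u: "u \<in> sig_space S j" and s: "0 \<le> s"
    and c: "pos S j s u a b \<le> c"
  shows "min_time S j a b c \<le> s + min_time S j (pos S j s u a b) (vel S j s u a b) c"
proof -
  note j = vehicle_state_vehicle[OF st]
  note ext = extreme_signals(2)[OF j]
  define m where "m = min_time S j (pos S j s u a b) (vel S j s u a b) c"
  have m: "0 \<le> m" "pos S j m (\<lambda>_. umax S j) (pos S j s u a b) (vel S j s u a b) = c"
    unfolding m_def using min_time_attained(1,2)[OF flow_state[OF st u s] c] by auto
  have "pos S j (s + m) (\<lambda>t. if t < s then u t else umax S j) a b = c"
    using flow_splice(2)[OF st u ext s, of "s + m"] m by simp
  then show ?thesis
    unfolding m_def[symmetric]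
    using m s c pos_ge_start[OF st u s]
    by (intro min_time_le[OF st spliced_signal[OF j u ext s]]) auto
qed

text \<open>
  The remainder of \<open>u\<close> is one way to reach \<open>c\<close> from the state at time \<open>s\<close>.
\<close>

lemma min_time_restart_le:
  assumes st: "vehicle_state j a b" and u: "u \<in> sig_space S j" and s: "0 \<le> s"
    and c: "pos S j s u a b \<le> c" and t: "c \<le> pos S j t u a b" "0 \<le> t"
  shows "min_time S j (pos S j s u a b) (vel S j s u a b) c \<le> t - s"
proof -
  have st': "s \<le> t" using pos_le_iff[OF st u s t(2)] c t by auto
  have "pos S j (t - s) (\<lambda>r. u (r + s)) (pos S j s u a b) (vel S j s u a b) = pos S j t u a b"
    using flow_restart(1)[OF st u s, of "t - s"] st' by simp
  then show ?thesis
    using st' c t by (intro min_time_le[OF flow_state[OF st u s]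
          restarted_signal[OF vehicle_state_vehicle[OF st] u s]]) auto
qed

text \<open>
  A signal that reaches \<open>c\<close> as early as possible may differ from the maximal input before that
  time, but it arrives with the same speed: the gap to the trajectory under maximal input is
  nonnegative and vanishes at the arrival time, so its derivative vanishes there as well.
\<close>

lemma speed_at_min_time:
  assumes st: "vehicle_state j a b" and u: "u \<in> sig_space S j" and c: "a < c"
    and hit: "pos S j (min_time S j a b c) u a b = c"
  shows "vel S j (min_time S j a b c) u a b = vel S j (min_time S j a b c) (\<lambda>_. umax S j) a b"
proof -
  note j = vehicle_state_vehicle[OF st]
  note ext = extreme_signals(2)[OF j]
  define T where "T = min_time S j a b c"
  note m = min_time_attained(1,2)[OF st less_imp_le[OF c], folded T_def]
  have "T \<noteq> 0" using m(2) flow_start(1)[OF st ext] c by auto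
  then have T: "0 < T" using m(1) by simp
  let ?d = "\<lambda>t. pos S j t (\<lambda>_. umax S j) a b - pos S j t u a b"
  have "(?d has_real_derivative vel S j T (\<lambda>_. umax S j) a b - vel S j T u a b) (at T)"
    by (intro DERIV_diff pos_derivative st u ext T)
  moreover have "\<forall>y. \<bar>T - y\<bar> < T \<longrightarrow> ?d T \<le> ?d y"
  proof (intro allI impI)
    fix y assume "\<bar>T - y\<bar> < T"
    then have "0 \<le> y" by auto
    then have "0 \<le> ?d y" using pos_mono[OF st st u ext, of y] signal_bounds[OF j u] by auto
    then show "?d T \<le> ?d y" using m(2) hit by (simp add: T_def)
  qed
  ultimately have "vel S j T (\<lambda>_. umax S j) a b - vel S j T u a b = 0" by (rule DERIV_local_min[OF _ T])
  then show ?thesis by (simp add: T_def)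
qed

lemma pos_eventually_maximal:
  assumes st: "vehicle_state j a b" and u: "u \<in> sig_space S j" and s: "0 \<le> s"
    and umax: "\<And>t. s \<le> t \<Longrightarrow> u t = umax S j" and t: "s \<le> t"
  shows "pos S j t u a b = pos S j (t - s) (\<lambda>_. umax S j) (pos S j s u a b) (vel S j s u a b)"
proof -
  note j = vehicle_state_vehicle[OF st]
  note ext = extreme_signals(2)[OF j]
  have "pos S j (t - s) (\<lambda>r. u (r + s)) (pos S j s u a b) (vel S j s u a b) = pos S j t u a b"
    using flow_restart(1)[OF st u s, of "t - s"] t by simp
  moreover have "pos S j (t - s) (\<lambda>r. u (r + s)) (pos S j s u a b) (vel S j s u a b)
      = pos S j (t - s) (\<lambda>_. umax S j) (pos S j s u a b) (vel S j s u a b)"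
    using umax t s by (intro flow_cong[OF flow_state[OF st u s] restarted_signal[OF j u s] ext]) auto
  ultimately show ?thesis by simp
qed

text \<open>
  By \<open>speed_at_min_time\<close>, a signal that reaches \<open>c\<close> as early as possible is there in the same state
  as under the maximal input; if it is maximal from then on, it is as early at all later points.
\<close>

lemma min_time_optimal_afterwards:
  assumes st: "vehicle_state j a b" and u: "u \<in> sig_space S j" and c: "a < c" "c \<le> d"
    and hit: "pos S j (min_time S j a b c) u a b = c"
    and umax: "\<And>t. min_time S j a b c \<le> t \<Longrightarrow> u t = umax S j"
  shows "pos S j (min_time S j a b d) u a b = d"
proof -
  note ext = extreme_signals(2)[OF vehicle_state_vehicle[OF st]]
  define T where "T = min_time S j a b c"
  note m = min_time_attained(1,2)[OF st less_imp_le[OF c(1)], folded T_def]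
  have ad: "a \<le> d" using c by simp
  note n = min_time_attained(1,2)[OF st ad]
  have "T \<le> min_time S j a b d" using pos_le_iff[OF st ext m(1) n(1)] m n c by simp
  then show ?thesis
    using pos_eventually_maximal[OF st u m(1), of "min_time S j a b d"]
      pos_eventually_maximal[OF st ext m(1), of "min_time S j a b d"]
      speed_at_min_time[OF st u c(1) hit] hit umax m n by (simp add: T_def)
qed

section \<open>First operations\<close>

lemma states_vehicle: "(x, v) \<in> states S \<Longrightarrow> j \<in> vehicles S \<Longrightarrow> vehicle_state j (x j) (v j)"
  unfolding states_def vehicle_state_def by auto

lemma ops_vehicle: "(i, j) \<in> ops S \<Longrightarrow> j \<in> vehicles S"
  using model unfolding intersection_model_def intersection_geometry_def by auto

lemma ops_interval: "(i, j) \<in> ops S \<Longrightarrow> \<alpha> S i j < \<beta> S i j"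
  using model unfolding intersection_model_def intersection_geometry_def by auto

lemma ops_ordered:
  "(i, j) \<in> ops S \<Longrightarrow> (i', j) \<in> ops S \<Longrightarrow> i \<noteq> i' \<Longrightarrow> \<beta> S i j \<le> \<alpha> S i' j \<or> \<beta> S i' j \<le> \<alpha> S i j"
  using model unfolding intersection_model_def intersection_geometry_def by blast

lemma finite_ops: "finite (ops S)"
proof (rule finite_subset)
  show "ops S \<subseteq> {1..n_conf S} \<times> vehicles S"
    using model unfolding intersection_model_def intersection_geometry_def by auto
qed (auto simp: vehicles_def)

lemma finite_entries: "finite {\<alpha> S i j |i. (i, j) \<in> ops S}"
proof -
  have "{\<alpha> S i j |i. (i, j) \<in> ops S} \<subseteq> (\<lambda>(i, j). \<alpha> S i j) ` ops S" by auto
  then show ?thesis using finite_ops by (meson finite_imageI finite_subset)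
qed

lemma \<alpha>min_le: "(i, j) \<in> ops S \<Longrightarrow> \<alpha>min S j \<le> \<alpha> S i j"
  unfolding \<alpha>min_def by (rule Min_le[OF finite_entries]) blast

lemma \<alpha>min_attained:
  assumes "(i, j) \<in> ops S"
  obtains i0 where "(i0, j) \<in> ops S" "\<alpha> S i0 j = \<alpha>min S j"
proof -
  have "\<alpha>min S j \<in> {\<alpha> S i j |i. (i, j) \<in> ops S}"
    unfolding \<alpha>min_def using assms by (intro Min_in finite_entries) auto
  then show thesis using that by auto
qed

lemma active_ops_ops: "(i, j) \<in> active_ops S x \<Longrightarrow> (i, j) \<in> ops S"
  and active_ops_ahead: "(i, j) \<in> active_ops S x \<Longrightarrow> x j < \<beta> S i j"
  unfolding active_ops_def by auto

lemma first_ops_active: "(i, j) \<in> first_ops S x \<Longrightarrow> (i, j) \<in> active_ops S x"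
  unfolding first_ops_def by auto

lemma first_ops_vehicle: "(i, j) \<in> first_ops S x \<Longrightarrow> j \<in> vehicles S"
  by (rule ops_vehicle[OF active_ops_ops[OF first_ops_active]])

lemma first_ops_least:
  "(i, j) \<in> first_ops S x \<Longrightarrow> (i', j) \<in> active_ops S x \<Longrightarrow> \<alpha> S i j \<le> \<alpha> S i' j"
  unfolding first_ops_def by auto

lemma finite_active_ops: "finite (active_ops S x)"
  by (rule finite_subset[OF _ finite_ops]) (auto simp: active_ops_def)

lemma finite_first_ops: "finite (first_ops S x)"
  by (rule finite_subset[OF _ finite_active_ops]) (auto dest: first_ops_active)

lemma first_ops_unique:
  assumes "(i, j) \<in> first_ops S x" "(i', j) \<in> first_ops S x"
  shows "i = i'"
proof (rule ccontr)
  assume "i \<noteq> i'"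
  note act = first_ops_active[OF assms(1)] first_ops_active[OF assms(2)]
  have "\<alpha> S i j = \<alpha> S i' j"
    using first_ops_least[OF assms(1) act(2)] first_ops_least[OF assms(2) act(1)] by simp
  then show False
    using ops_ordered[OF active_ops_ops[OF act(1)] active_ops_ops[OF act(2)] \<open>i \<noteq> i'\<close>]
      ops_interval[OF active_ops_ops[OF act(1)]] ops_interval[OF active_ops_ops[OF act(2)]] by auto
qed

lemma first_of_eq: "(i, j) \<in> first_ops S x \<Longrightarrow> first_of S x j = i"
  unfolding first_of_def using first_ops_unique by blast

lemma first_of_first:
  assumes "(i, j) \<in> active_ops S x"
  shows "(first_of S x j, j) \<in> first_ops S x"
proof -
  let ?I = "{i. (i, j) \<in> active_ops S x}"
  have "?I \<subseteq> fst ` active_ops S x" by force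
  then have fin: "finite ?I" using finite_active_ops by (meson finite_imageI finite_subset)
  obtain i0 where i0: "i0 \<in> ?I" "\<And>i. i \<in> ?I \<Longrightarrow> \<alpha> S i0 j \<le> \<alpha> S i j"
    using ex_min_if_finite[of "(\<lambda>i. \<alpha> S i j) ` ?I"] fin assms by fastforce
  then have "(i0, j) \<in> first_ops S x" unfolding first_ops_def by auto
  then show ?thesis using first_of_eq by simp
qed

text \<open>
  Conflict areas on a path are disjoint, so the only active operation that a vehicle can have
  entered already is its first one.
\<close>

lemma entered_is_first:
  assumes act: "(i, j) \<in> active_ops S x" and "\<alpha> S i j \<le> x j"
  shows "(i, j) \<in> first_ops S x"
  unfolding first_ops_def
proof (intro CollectI case_prodI conjI allI impI act)
  fix i' assume act': "(i', j) \<in> active_ops S x"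
  show "\<alpha> S i j \<le> \<alpha> S i' j"
    using ops_ordered[OF active_ops_ops[OF act] active_ops_ops[OF act']]
      ops_interval[OF active_ops_ops[OF act]] active_ops_ahead[OF act'] assms(2)
    by (cases "i = i'") auto
qed

lemma active_ops_approaching:
  assumes "x j < \<alpha>min S j"
  shows "(i, j) \<in> active_ops S x \<longleftrightarrow> (i, j) \<in> ops S"
  using assms \<alpha>min_le ops_interval unfolding active_ops_def by force

lemma first_ops_approaching:
  assumes "x j < \<alpha>min S j" "(i, j) \<in> first_ops S x"
  shows "\<alpha> S i j = \<alpha>min S j"
proof -
  have i: "(i, j) \<in> ops S" by (rule active_ops_ops[OF first_ops_active[OF assms(2)]])
  obtain i0 where i0: "(i0, j) \<in> ops S" "\<alpha> S i0 j = \<alpha>min S j" by (rule \<alpha>min_attained[OF i])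
  have "(i0, j) \<in> active_ops S x" using i0(1) active_ops_approaching[of x j i0] assms(1) by simp
  then show ?thesis using first_ops_least[OF assms(2)] \<alpha>min_le[OF i] i0 by fastforce
qed

lemma first_ops_same_if_approaching:
  assumes "x j < \<alpha>min S j" "x' j < \<alpha>min S j"
  shows "(i, j) \<in> first_ops S x \<longleftrightarrow> (i, j) \<in> first_ops S x'"
    and "first_of S x j = first_of S x' j"
proof -
  have "(i, j) \<in> first_ops S x \<longleftrightarrow> (i, j) \<in> first_ops S x'" for i
    using active_ops_approaching[of x j] active_ops_approaching[of x' j] assms
    unfolding first_ops_def by auto
  then show "(i, j) \<in> first_ops S x \<longleftrightarrow> (i, j) \<in> first_ops S x'"
    and "first_of S x j = first_of S x' j"
    unfolding first_of_def by auto
qed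

section \<open>Schedules without delay\<close>

text \<open>
  Of the conditions on a feasible schedule of delay 0, these are the ones that concern a single
  vehicle.  Delay 0 means that no first operation starts after its deadline \<open>D_bar\<close>
  (\<open>objective_zero_iff\<close>); the arcs between vehicles are left to \<open>feasible\<close>.
\<close>

definition prompt :: "state \<Rightarrow> schedule \<Rightarrow> bool" where
  "prompt z T \<longleftrightarrow> T \<in> schedule_domain S z \<and>
     (\<forall>(i, j)\<in>first_ops S (fst z). R_bar S z i j \<le> T i j \<and> T i j \<le> D_bar S z i j)"

lemma objective_nonneg: "0 \<le> objective S z T"
  unfolding objective_def by (rule Max_ge) (simp_all add: finite_first_ops)

lemma objective_zero_iff:
  "objective S z T = 0 \<longleftrightarrow> (\<forall>(i, j)\<in>first_ops S (fst z). T i j \<le> D_bar S z i j)"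
proof -
  have "objective S z T = 0 \<longleftrightarrow> objective S z T \<le> 0" using objective_nonneg[of z T] by auto
  also have "\<dots> \<longleftrightarrow> (\<forall>(i, j)\<in>first_ops S (fst z). T i j \<le> D_bar S z i j)"
    unfolding objective_def by (subst Max_le_iff) (auto simp: finite_first_ops)
  finally show ?thesis .
qed

lemma feasibleD:
  assumes "(T, k) \<in> feasible S M z"
  shows "T \<in> schedule_domain S z"
    and "(i, j) \<in> first_ops S (fst z) \<Longrightarrow> R_bar S z i j \<le> T i j"
    and "(i, j, j') \<in> arcs S (fst z) \<Longrightarrow> k i j j' \<in> {0, 1} \<and> k i j' j \<in> {0, 1} \<and>
      P_bar S z T i j \<le> T_bar S z T i j' + M * (1 - real (k i j j')) \<and>
      P_bar S z T i j' \<le> T_bar S z T i j + M * (1 - real (k i j' j)) \<and>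
      k i j j' + k i j' j = 1"
proof -
  note * = assms[unfolded feasible_def mem_Collect_eq prod.case]
  show "T \<in> schedule_domain S z" using * by blast
  show "R_bar S z i j \<le> T i j" if "(i, j) \<in> first_ops S (fst z)"
    using bspec[OF conjunct1[OF conjunct2[OF *]] that] by simp
  show "k i j j' \<in> {0, 1} \<and> k i j' j \<in> {0, 1} \<and>
      P_bar S z T i j \<le> T_bar S z T i j' + M * (1 - real (k i j j')) \<and>
      P_bar S z T i j' \<le> T_bar S z T i j + M * (1 - real (k i j' j)) \<and>
      k i j j' + k i j' j = 1" if "(i, j, j') \<in> arcs S (fst z)"
    using bspec[OF conjunct2[OF conjunct2[OF *]] that] by (simp only: prod.case)
qed

lemma feasible_zero_prompt:
  "(T, k) \<in> feasible S M z \<Longrightarrow> objective S z T = 0 \<Longrightarrow> prompt z T"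
  unfolding feasible_def prompt_def objective_zero_iff by fastforce

lemma prompt_hits:
  assumes "prompt (x, v) T" "(i, j) \<in> first_ops S x" "x j < \<alpha> S i j"
  shows "T i j \<in> hit_times S j (x j) (v j) (\<alpha> S i j)"
  using assms unfolding prompt_def by fastforce

lemma prompt_entered:
  assumes "prompt (x, v) T" "(i, j) \<in> first_ops S x" "\<alpha> S i j \<le> x j"
  shows "T i j = 0"
  using assms unfolding prompt_def by fastforce

text \<open>
  For a vehicle past the entry of the intersection, release time and deadline coincide, so that a
  schedule of delay 0 has no freedom.  Consequently all planned times that lie ahead are its fastest
  arrival times, as \<open>T_bar_inside\<close> and \<open>P_bar_inside\<close> spell out.
\<close>

lemma prompt_inside:
  assumes "prompt (x, v) T" "(i, j) \<in> first_ops S x" "\<alpha>min S j \<le> x j"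
  shows "T i j = R_bar S (x, v) i j"
  using assms unfolding prompt_def by (fastforce split: if_splits)

lemma T_bar_first: "(i, j) \<in> first_ops S x \<Longrightarrow> T_bar S (x, v) T i j = T i j"
  by (simp add: Let_def)

lemma T_bar_approaching:
  assumes "x j < \<alpha>min S j" "(i, j) \<notin> first_ops S x"
  shows "T_bar S (x, v) T i j =
           T (first_of S x j) j + min_time S j (\<alpha>min S j) (vmax S j) (\<alpha> S i j)"
  using assms by (simp add: Let_def)

lemma P_bar_approaching:
  assumes "x j < \<alpha>min S j"
  shows "P_bar S (x, v) T i j =
           T (first_of S x j) j + min_time S j (\<alpha>min S j) (vmin S j) (\<beta> S i j)"
  using assms first_of_eq[of i j x] first_ops_approaching[of x j i] by (simp add: Let_def)

lemma T_bar_inside: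
  assumes T: "prompt (x, v) T" and ge: "\<alpha>min S j \<le> x j" and act: "(i, j) \<in> active_ops S x"
  shows "T_bar S (x, v) T i j =
           (if x j < \<alpha> S i j then min_time S j (x j) (v j) (\<alpha> S i j) else 0)"
proof (cases "(i, j) \<in> first_ops S x")
  case True
  then show ?thesis using prompt_inside[OF T True ge] ge by simp
next
  case False
  then have "x j < \<alpha> S i j" using entered_is_first[OF act] by force
  moreover have "T (first_of S x j) j = R_bar S (x, v) (first_of S x j) j"
    by (rule prompt_inside[OF T first_of_first[OF act] ge])
  ultimately show ?thesis using False ge by (simp add: Let_def del: R_bar.simps)
qed

lemma P_bar_inside:
  assumes T: "prompt (x, v) T" and ge: "\<alpha>min S j \<le> x j" and act: "(i, j) \<in> active_ops S x"
  shows "P_bar S (x, v) T i j = min_time S j (x j) (v j) (\<beta> S i j)"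
proof -
  have "T (first_of S x j) j = R_bar S (x, v) (first_of S x j) j"
    by (rule prompt_inside[OF T first_of_first[OF act] ge])
  then show ?thesis
    using first_of_eq[of i j x] ge
    by (cases "(i, j) \<in> first_ops S x") (simp_all add: Let_def del: R_bar.simps)
qed

declare T_bar.simps [simp del] and P_bar.simps [simp del]

section \<open>The input generator\<close>

text \<open>
  The scheduled time of a first operation ahead of the vehicle is hit by some signal; the maximal
  input from that time on leaves the arrival time unchanged.  Each vehicle has at most one first
  operation, so there is only one such condition per vehicle.
\<close>

lemma generated_signals_nonempty:
  assumes z: "(x, v) \<in> states S" and T: "T \<in> schedule_domain S (x, v)"
  shows "generated_signals S (x, v) T \<noteq> {}"
proof -
  define good where "good j w \<longleftrightarrow> w \<in> sig_space S j \<and> (\<forall>i. (i, j) \<in> first_ops S x \<longrightarrow>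
          (x j < \<alpha> S i j \<longrightarrow> pos S j (T i j) w (x j) (v j) = \<alpha> S i j) \<and>
          (\<forall>t\<ge>T i j. w t = umax S j))" for j w
  have "\<exists>w. good j w"
    if j: "j \<in> vehicles S" for j
  proof (cases "\<exists>i. (i, j) \<in> first_ops S x \<and> x j < \<alpha> S i j")
    case True
    then obtain i where i: "(i, j) \<in> first_ops S x" "x j < \<alpha> S i j" by auto
    then have "T i j \<in> hit_times S j (x j) (v j) (\<alpha> S i j)" using T by fastforce
    then obtain u where u: "0 \<le> T i j" "u \<in> sig_space S j"
      "pos S j (T i j) u (x j) (v j) = \<alpha> S i j" unfolding hit_times_def by auto
    let ?w = "\<lambda>t. if t < T i j then u t else umax S j"
    have "?w \<in> sig_space S j" by (rule spliced_signal[OF j u(2) extreme_signals(2)[OF j] u(1)])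
    moreover have "pos S j (T i j) ?w (x j) (v j) = \<alpha> S i j"
      using flow_splice(1)[OF states_vehicle[OF z j] u(2) extreme_signals(2)[OF j] u(1) u(1) order_refl]
        u(3) by simp
    ultimately show ?thesis using first_ops_unique[OF i(1)] unfolding good_def by (intro exI[of _ ?w]) auto
  next
    case False
    then have "good j (\<lambda>_. umax S j)" using extreme_signals(2)[OF j] unfolding good_def by auto
    then show ?thesis by blast
  qed
  then have "\<forall>j\<in>vehicles S. \<exists>w. good j w" by blast
  from bchoice[OF this] obtain u where "\<forall>j\<in>vehicles S. good j (u j)" by blast
  then have "u \<in> generated_signals S (x, v) T" unfolding good_def using first_ops_vehicle by auto
  then show ?thesis by blast
qed

lemma evolve_states:
  assumes z: "z \<in> states S" and u: "\<And>j. j \<in> vehicles S \<Longrightarrow> u j \<in> sig_space S j" and "0 \<le> t"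
  shows "evolve S t u z \<in> states S"
proof -
  obtain x v where [simp]: "z = (x, v)" by (cases z)
  have "vehicle_state j (pos S j t (u j) (x j) (v j)) (vel S j t (u j) (x j) (v j))"
    if "j \<in> vehicles S" for j
    using flow_state[OF states_vehicle[of x v j] u \<open>0 \<le> t\<close>] z that by simp
  then show ?thesis unfolding states_def evolve_def vehicle_state_def by simp
qed

section \<open>A time step preserves schedules without delay\<close>

lemma generated_signals_sig:
  "u \<in> generated_signals S (x, v) T \<Longrightarrow> j \<in> vehicles S \<Longrightarrow> u j \<in> sig_space S j"
  by simp

lemma generated_signals_hit:
  assumes "u \<in> generated_signals S (x, v) T" "(i, j) \<in> first_ops S x" "x j < \<alpha> S i j"
  shows "pos S j (T i j) (u j) (x j) (v j) = \<alpha> S i j"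
  using assms by fastforce

lemma generated_signals_max:
  assumes "u \<in> generated_signals S (x, v) T" "(i, j) \<in> first_ops S x" "T i j \<le> t"
  shows "u j t = umax S j"
  using assms by fastforce

text \<open>
  A vehicle that has yet to reach the intersection enters it at its scheduled time and then applies
  the maximal input; \<open>P_bar\<close> assumes that it does so at minimal speed, which can only be slower.  A
  vehicle past the entry is in a conflict area already or reaches the next one as early as possible.
  From then on it applies the maximal input, so it leaves all conflict areas at the earliest times,
  which are the values of \<open>P_bar\<close>.
\<close>

lemma exit_by_P_bar:
  assumes z: "(x, v) \<in> states S" and T: "prompt (x, v) T" and u: "u \<in> generated_signals S (x, v) T"
    and act: "(i, j) \<in> active_ops S x"
  shows "0 \<le> P_bar S (x, v) T i j"
    and "\<beta> S i j \<le> pos S j (P_bar S (x, v) T i j) (u j) (x j) (v j)"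
proof -
  note j = ops_vehicle[OF active_ops_ops[OF act]]
  note st = states_vehicle[OF z j]
  note uj = generated_signals_sig[OF u j]
  note ext = extreme_signals(2)[OF j]
  \<comment> \<open>The scheduled times of all operations of a vehicle derive from that of its first one.\<close>
  define f where "f = first_of S x j"
  have f: "(f, j) \<in> first_ops S x" unfolding f_def by (rule first_of_first[OF act])
  have f_le: "\<alpha> S f j \<le> \<alpha> S i j" by (rule first_ops_least[OF f act])
  note \<beta> = ops_interval[OF active_ops_ops[OF act]]
  have "0 \<le> P_bar S (x, v) T i j \<and> \<beta> S i j \<le> pos S j (P_bar S (x, v) T i j) (u j) (x j) (v j)"
  proof (cases "x j < \<alpha>min S j")
    case True
    have f_min: "\<alpha> S f j = \<alpha>min S j" by (rule first_ops_approaching[of x j f, OF True f])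
    have hit: "pos S j (T f j) (u j) (x j) (v j) = \<alpha>min S j"
      using generated_signals_hit[OF u f] True f_min by simp
    have T0: "0 \<le> T f j" using prompt_hits[OF T f] True f_min by (simp add: hit_times_def)
    define b where "b = vel S j (T f j) (u j) (x j) (v j)"
    have st': "vehicle_state j (\<alpha>min S j) b"
      using flow_state[OF st uj T0] hit by (simp add: b_def)
    define m where "m = min_time S j (\<alpha>min S j) (vmin S j) (\<beta> S i j)"
    have m: "0 \<le> m" "pos S j m (\<lambda>_. umax S j) (\<alpha>min S j) (vmin S j) = \<beta> S i j"
      unfolding m_def
      using min_time_attained(1,2)[OF extreme_speeds(1)[OF st'], of "\<beta> S i j"] \<beta> f_le f_min by auto
    have "\<beta> S i j \<le> pos S j m (\<lambda>_. umax S j) (\<alpha>min S j) b"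
      using pos_mono[OF extreme_speeds(1)[OF st'] st' ext ext order_refl extreme_speeds(3)[OF st'] m(1)]
        m(2) by simp
    also have "\<dots> = pos S j (T f j + m) (u j) (x j) (v j)"
      using pos_eventually_maximal[OF st uj T0 generated_signals_max[OF u f], of "T f j + m"]
        hit m(1) by (simp add: b_def)
    finally show ?thesis
      unfolding P_bar_approaching[of x j, OF True] f_def[symmetric] m_def[symmetric] using m T0 by simp
  next
    case False
    then have inside: "\<alpha>min S j \<le> x j" by simp
    note P = P_bar_inside[OF T inside act]
    note m = min_time_attained(1,2)[OF st less_imp_le[OF active_ops_ahead[OF act]]]
    have "pos S j (min_time S j (x j) (v j) (\<beta> S i j)) (u j) (x j) (v j) = \<beta> S i j"
    proof (cases "x j < \<alpha> S f j")
      case True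
      have Tf: "T f j = min_time S j (x j) (v j) (\<alpha> S f j)"
        using prompt_inside[OF T f inside] True False by simp
      have "\<alpha> S f j \<le> \<beta> S i j" using f_le \<beta> by simp
      then show ?thesis
        by (rule min_time_optimal_afterwards[OF st uj True])
          (use generated_signals_hit[OF u f True] generated_signals_max[OF u f] in \<open>simp_all only: Tf\<close>)
    next
      case entered: False
      then have "T f j = 0" using prompt_entered[OF T f] by simp
      then have "pos S j t (u j) (x j) (v j) = pos S j t (\<lambda>_. umax S j) (x j) (v j)" if "0 \<le> t" for t
        using generated_signals_max[OF u f] that by (intro flow_cong[OF st uj ext]) auto
      with m show ?thesis by simp
    qed
    then show ?thesis using m P by simp
  qed
  then show "0 \<le> P_bar S (x, v) T i j"
    and "\<beta> S i j \<le> pos S j (P_bar S (x, v) T i j) (u j) (x j) (v j)" by auto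
qed

text \<open>
  At time \<open>s\<close> the vehicle is past the entry of the intersection.  The right-hand side is the earliest
  time, counted from \<open>s\<close>, at which it can be in conflict area \<open>i\<close> if it is free to choose its input
  anew.  Unless \<open>T_bar\<close> is 0 or the scheduled time at the entry, it is the earliest arrival time
  from an earlier position on the trajectory, computed with maximal speed if that position is the
  entry of the intersection.
\<close>

lemma no_entry_before_T_bar:
  assumes z: "(x, v) \<in> states S" and T: "prompt (x, v) T" and u: "u \<in> generated_signals S (x, v) T"
    and act: "(i, j) \<in> active_ops S x" and s: "0 \<le> s"
    and passed: "\<alpha>min S j \<le> pos S j s (u j) (x j) (v j)"
  shows "T_bar S (x, v) T i j - s \<le>
    (let a = pos S j s (u j) (x j) (v j); b = vel S j s (u j) (x j) (v j)
     in if a < \<alpha> S i j then min_time S j a b (\<alpha> S i j) else 0)"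
proof -
  note j = ops_vehicle[OF active_ops_ops[OF act]]
  note st = states_vehicle[OF z j]
  note uj = generated_signals_sig[OF u j]
  define a b where "a = pos S j s (u j) (x j) (v j)" and "b = vel S j s (u j) (x j) (v j)"
  have le: "min_time S j (pos S j r (u j) (x j) (v j)) (vel S j r (u j) (x j) (v j)) (\<alpha> S i j) - (s - r)
      \<le> (if a < \<alpha> S i j then min_time S j a b (\<alpha> S i j) else 0)"
    if r: "0 \<le> r" "r \<le> s" "pos S j r (u j) (x j) (v j) \<le> \<alpha> S i j" for r
  proof (cases "a < \<alpha> S i j")
    case True
    have 1: "pos S j (s - r) (\<lambda>t. u j (t + r)) (pos S j r (u j) (x j) (v j)) (vel S j r (u j) (x j) (v j)) = a"
      "vel S j (s - r) (\<lambda>t. u j (t + r)) (pos S j r (u j) (x j) (v j)) (vel S j r (u j) (x j) (v j)) = b"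
      using flow_restart[OF st uj r(1), of "s - r"] r(2) by (simp_all add: a_def b_def)
    show ?thesis
      using min_time_dynamic_programming[OF flow_state[OF st uj r(1)]
          restarted_signal[OF j uj r(1)], of "s - r" "\<alpha> S i j"] True r(2)
      unfolding 1 by simp
  next
    case False
    then show ?thesis
      using min_time_restart_le[OF st uj r(1,3), of s] s by (simp add: a_def)
  qed
  have "T_bar S (x, v) T i j - s \<le> (if a < \<alpha> S i j then min_time S j a b (\<alpha> S i j) else 0)"
  proof (cases "x j < \<alpha>min S j")
    case True
    define f where "f = first_of S x j"
    have f: "(f, j) \<in> first_ops S x" unfolding f_def by (rule first_of_first[OF act])
    have f_min: "\<alpha> S f j = \<alpha>min S j" by (rule first_ops_approaching[of x j f, OF True f])
    have hit: "pos S j (T f j) (u j) (x j) (v j) = \<alpha>min S j"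
      using generated_signals_hit[OF u f] True f_min by simp
    have T0: "0 \<le> T f j" using prompt_hits[OF T f] True f_min by (simp add: hit_times_def)
    have Ts: "T f j \<le> s" using pos_le_iff[OF st uj T0 s] hit passed by simp
    have st': "vehicle_state j (\<alpha>min S j) (vel S j (T f j) (u j) (x j) (v j))"
      using flow_state[OF st uj T0] hit by simp
    have \<alpha>: "\<alpha>min S j \<le> \<alpha> S i j" by (rule \<alpha>min_le[OF active_ops_ops[OF act]])
    show ?thesis
    proof (cases "(i, j) \<in> first_ops S x")
      case True
      then have "i = f" using first_ops_unique f by blast
      then have "\<not> a < \<alpha> S i j" using f_min passed by (simp add: a_def)
      then show ?thesis using T_bar_first[OF True] Ts \<open>i = f\<close> by simp
    next
      case nf: False
      \<comment> \<open>The bound assumes maximal speed at the entry; the vehicle enters at most that fast.\<close>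
      have "min_time S j (\<alpha>min S j) (vmax S j) (\<alpha> S i j)
          \<le> min_time S j (\<alpha>min S j) (vel S j (T f j) (u j) (x j) (v j)) (\<alpha> S i j)"
        by (rule min_time_antimono_speed[OF st' extreme_speeds(2,4)[OF st'] \<alpha>])
      then show ?thesis
        using le[OF T0 Ts] hit \<alpha> T_bar_approaching[of x j i v T, OF True nf]
        unfolding f_def[symmetric] by simp
    qed
  next
    case False
    then have inside: "\<alpha>min S j \<le> x j" by simp
    show ?thesis
    proof (cases "x j < \<alpha> S i j")
      case True
      then show ?thesis
        using le[OF order_refl s] flow_start[OF st uj] T_bar_inside[OF T inside act] by simp
    next
      case False
      moreover have "x j \<le> a" unfolding a_def by (rule pos_ge_start[OF st uj s])
      ultimately show ?thesis using T_bar_inside[OF T inside act] s by simp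
    qed
  qed
  then show ?thesis unfolding Let_def a_def b_def .
qed

text \<open>
  While a vehicle has yet to reach the intersection, its plan is kept and merely shifted.  Once it
  is past the entry, its release time and deadline coincide and dictate the scheduled time.
\<close>

definition advance :: "real \<Rightarrow> state \<Rightarrow> schedule \<Rightarrow> schedule" where
  "advance s z T = (\<lambda>i j.
     if fst z j < \<alpha>min S j then T i j - s
     else if fst z j < \<alpha> S i j then min_time S j (fst z j) (snd z j) (\<alpha> S i j)
     else 0)"

lemma evolve_fst_snd:
  "fst (evolve S s u (x, v)) = (\<lambda>j. pos S j s (u j) (x j) (v j))"
  "snd (evolve S s u (x, v)) = (\<lambda>j. vel S j s (u j) (x j) (v j))"
  by (simp_all add: evolve_def)

context
  fixes x v x' v' T u and s :: real
  assumes z: "(x, v) \<in> states S" and T: "prompt (x, v) T"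
    and u: "u \<in> generated_signals S (x, v) T" and s: "0 \<le> s"
    and z': "evolve S s u (x, v) = (x', v')"
begin

lemma evolved:
  "x' j = pos S j s (u j) (x j) (v j)" "v' j = vel S j s (u j) (x j) (v j)"
  using evolve_fst_snd[of s u x v] z' by auto

lemma evolved_states: "(x', v') \<in> states S"
  using evolve_states[OF z generated_signals_sig[OF u] s] z' by simp

lemma evolved_ge: "j \<in> vehicles S \<Longrightarrow> x j \<le> x' j"
  unfolding evolved by (rule pos_ge_start[OF states_vehicle[OF z] generated_signals_sig[OF u] s])

lemma evolved_active_ops:
  assumes "(i, j) \<in> active_ops S x'"
  shows "(i, j) \<in> active_ops S x"
  using assms evolved_ge[of j] ops_vehicle[of i j] unfolding active_ops_def by force

lemma prompt_advance: "prompt (x', v') (advance s (x', v') T)"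
proof -
  have main: "(if x' j < \<alpha> S i j then advance s (x', v') T i j \<in> hit_times S j (x' j) (v' j) (\<alpha> S i j)
           else advance s (x', v') T i j = 0) \<and>
        R_bar S (x', v') i j \<le> advance s (x', v') T i j \<and>
        advance s (x', v') T i j \<le> D_bar S (x', v') i j"
    if f': "(i, j) \<in> first_ops S x'" for i j
  proof -
    note j = first_ops_vehicle[OF f']
    note st = states_vehicle[OF z j] and st' = states_vehicle[OF evolved_states j]
    note uj = generated_signals_sig[OF u j]
    show ?thesis
    proof (cases "x' j < \<alpha>min S j")
      case True
      have x: "x j < \<alpha>min S j" using True evolved_ge[OF j] by simp
      have f: "(i, j) \<in> first_ops S x" using first_ops_same_if_approaching(1)[of x j x' i, OF x True] f' by simp
      have eq: "\<alpha> S i j = \<alpha>min S j" by (rule first_ops_approaching[of x j i, OF x f])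
      have T0: "0 \<le> T i j" using prompt_hits[OF T f] x eq by (simp add: hit_times_def)
      have hit: "pos S j (T i j) (u j) (x j) (v j) = \<alpha>min S j"
        using generated_signals_hit[OF u f] x eq by simp
      then have sT: "s \<le> T i j" using pos_le_iff[OF st uj s T0] True unfolding evolved by simp
      have "pos S j (T i j - s) (\<lambda>t. u j (t + s)) (x' j) (v' j) = \<alpha>min S j"
        using flow_restart(1)[OF st uj s, of "T i j - s"] sT hit unfolding evolved by simp
      then have "T i j - s \<in> hit_times S j (x' j) (v' j) (\<alpha>min S j)"
        unfolding hit_times_def using sT restarted_signal[OF j uj s] by auto
      then show ?thesis
        using True eq min_time_attained(3)[OF st', of "\<alpha>min S j"] by (simp add: advance_def)
    next
      case False
      then show ?thesis using min_time_hits[OF st', of "\<alpha> S i j"] by (auto simp: advance_def)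
    qed
  qed
  show ?thesis unfolding prompt_def by (auto dest!: main simp del: R_bar.simps D_bar.simps)
qed

text \<open>
  Past the entry of the intersection, the new \<open>P_bar\<close> is the earliest time at which the conflict area
  can be left, and the signal in use has left it by the old \<open>P_bar\<close>.
\<close>

lemma P_bar_advance:
  assumes act': "(i, j) \<in> active_ops S x'"
  shows "P_bar S (x', v') (advance s (x', v') T) i j \<le> P_bar S (x, v) T i j - s"
proof (cases "x' j < \<alpha>min S j")
  case True
  note act = evolved_active_ops[OF act']
  have x: "x j < \<alpha>min S j" using True evolved_ge[OF ops_vehicle[OF active_ops_ops[OF act]]] by simp
  show ?thesis
    using True first_ops_same_if_approaching(2)[of x j x', OF x True]
    unfolding P_bar_approaching[of x j, OF x] P_bar_approaching[of x' j, OF True] by (simp add: advance_def)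
next
  case False
  note act = evolved_active_ops[OF act']
  note j = ops_vehicle[OF active_ops_ops[OF act]]
  have "P_bar S (x', v') (advance s (x', v') T) i j = min_time S j (x' j) (v' j) (\<beta> S i j)"
    using P_bar_inside[OF prompt_advance _ act'] False by simp
  also have "\<dots> \<le> P_bar S (x, v) T i j - s"
    using exit_by_P_bar[OF z T u act] active_ops_ahead[OF act'] unfolding evolved
    by (intro min_time_restart_le[OF states_vehicle[OF z j] generated_signals_sig[OF u j] s]) auto
  finally show ?thesis .
qed

text \<open>
  Past the entry of the intersection, this is \<open>no_entry_before_T_bar\<close>; before it, both sides are equal.
\<close>

lemma T_bar_advance:
  assumes act': "(i, j) \<in> active_ops S x'"
  shows "T_bar S (x, v) T i j - s \<le> T_bar S (x', v') (advance s (x', v') T) i j"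
proof (cases "x' j < \<alpha>min S j")
  case True
  note act = evolved_active_ops[OF act']
  have x: "x j < \<alpha>min S j" using True evolved_ge[OF ops_vehicle[OF active_ops_ops[OF act]]] by simp
  note same = first_ops_same_if_approaching[of x j x', OF x True]
  show ?thesis
  proof (cases "(i, j) \<in> first_ops S x")
    case f: True
    then have f': "(i, j) \<in> first_ops S x'" using same(1) by simp
    show ?thesis unfolding T_bar_first[OF f] T_bar_first[OF f'] using True by (simp add: advance_def)
  next
    case f: False
    then have f': "(i, j) \<notin> first_ops S x'" using same(1) by simp
    show ?thesis
      using same(2) True
      unfolding T_bar_approaching[of x j i, OF x f] T_bar_approaching[of x' j i, OF True f']
      by (simp add: advance_def)
  qed
next
  case False
  then have "T_bar S (x', v') (advance s (x', v') T) i j =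
      (if x' j < \<alpha> S i j then min_time S j (x' j) (v' j) (\<alpha> S i j) else 0)"
    using T_bar_inside[OF prompt_advance _ act'] by simp
  then show ?thesis
    using no_entry_before_T_bar[OF z T u evolved_active_ops[OF act'] s] False
    unfolding evolved Let_def by simp
qed

lemma objective_advance: "objective S (x', v') (advance s (x', v') T) = 0"
  using prompt_advance unfolding objective_zero_iff prompt_def by auto

text \<open>
  Operations only ever become inactive, so every new arc is an old one.  Its constraints compare a
  \<open>P_bar\<close> with a \<open>T_bar\<close>, and the former decreases by at least \<open>s\<close> while the latter decreases by at
  most \<open>s\<close>.
\<close>

lemma feasible_advance:
  assumes feas: "(T, k) \<in> feasible S M (x, v)"
  shows "(advance s (x', v') T, k) \<in> feasible S M (x', v')"
proof -
  note p = prompt_advance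
  have arc: "k i j j' \<in> {0, 1} \<and> k i j' j \<in> {0, 1} \<and>
     P_bar S (x', v') (advance s (x', v') T) i j
       \<le> T_bar S (x', v') (advance s (x', v') T) i j' + M * (1 - real (k i j j')) \<and>
     P_bar S (x', v') (advance s (x', v') T) i j'
       \<le> T_bar S (x', v') (advance s (x', v') T) i j + M * (1 - real (k i j' j)) \<and>
     k i j j' + k i j' j = 1" if "(i, j, j') \<in> arcs S x'" for i j j'
  proof -
    have act: "(i, j) \<in> active_ops S x'" "(i, j') \<in> active_ops S x'" "j \<noteq> j'"
      using that unfolding arcs_def by auto
    then have "(i, j, j') \<in> arcs S x" using evolved_active_ops unfolding arcs_def by auto
    then show ?thesis
      using feasibleD(3)[OF feas, of i j j', unfolded fst_conv] P_bar_advance[OF act(1)] P_bar_advance[OF act(2)]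
        T_bar_advance[OF act(1)] T_bar_advance[OF act(2)] by linarith
  qed
  then show "(advance s (x', v') T, k) \<in> feasible S M (x', v')"
    using p unfolding feasible_def prompt_def
    by (auto simp del: R_bar.simps D_bar.simps schedule_domain.simps)
qed

end

section \<open>Existence of optimal schedules\<close>

lemma P_bar_cong:
  assumes "\<And>i j. (i, j) \<in> first_ops S (fst z) \<Longrightarrow> T i j = T' i j" "(i, j) \<in> active_ops S (fst z)"
  shows "P_bar S z T i j = P_bar S z T' i j"
  using assms first_of_first[OF assms(2)] by (cases z) (auto simp: P_bar.simps Let_def)

lemma T_bar_cong:
  assumes "\<And>i j. (i, j) \<in> first_ops S (fst z) \<Longrightarrow> T i j = T' i j" "(i, j) \<in> active_ops S (fst z)"
  shows "T_bar S z T i j = T_bar S z T' i j"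
  using assms first_of_first[OF assms(2)] by (cases z) (auto simp: T_bar.simps Let_def)

lemma objective_cong:
  assumes "\<And>i j. (i, j) \<in> first_ops S (fst z) \<Longrightarrow> T i j = T' i j"
  shows "objective S z T = objective S z T'"
  unfolding objective_def
  by (intro arg_cong[where f = Max] arg_cong[where f = "insert 0"] image_cong) (auto simp: assms)

lemma arcs_active:
  assumes "(i, j, j') \<in> arcs S x"
  shows "(i, j) \<in> active_ops S x" "(i, j') \<in> active_ops S x" "(i, j', j) \<in> arcs S x"
  using assms unfolding arcs_def by auto

text \<open>
  Entries of a schedule outside the first operations, and binary variables outside the arcs, do not
  influence feasibility.  They can be set to 0, which confines schedules and variables to a compact
  set.
\<close>

lemma feasible_cong:
  assumes "(T, k) \<in> feasible S M z"
    and T': "\<And>i j. (i, j) \<in> first_ops S (fst z) \<Longrightarrow> T i j = T' i j"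
    and k': "\<And>i j j'. (i, j, j') \<in> arcs S (fst z) \<Longrightarrow> k i j j' = k' i j j'"
  shows "(T', k') \<in> feasible S M z"
proof -
  have "T' \<in> schedule_domain S z"
    using feasibleD(1)[OF assms(1)] T' by (cases z) fastforce
  moreover have "\<forall>(i, j)\<in>first_ops S (fst z). R_bar S z i j \<le> T' i j"
    using feasibleD(2)[OF assms(1)] T' by fastforce
  moreover have "k' i j j' \<in> {0, 1} \<and> k' i j' j \<in> {0, 1} \<and>
      P_bar S z T' i j \<le> T_bar S z T' i j' + M * (1 - real (k' i j j')) \<and>
      P_bar S z T' i j' \<le> T_bar S z T' i j + M * (1 - real (k' i j' j)) \<and>
      k' i j j' + k' i j' j = 1" if a: "(i, j, j') \<in> arcs S (fst z)" for i j j'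
  proof -
    show ?thesis
      using feasibleD(3)[OF assms(1) a] P_bar_cong[OF T' arcs_active(1)[OF a]] P_bar_cong[OF T' arcs_active(2)[OF a]]
        T_bar_cong[OF T' arcs_active(1)[OF a]] T_bar_cong[OF T' arcs_active(2)[OF a]]
        k'[OF a] k'[OF arcs_active(3)[OF a]] by simp
  qed
  ultimately show ?thesis unfolding feasible_def by auto
qed

lemma continuous_on_schedule_entry:
  fixes f :: "'a::topological_space \<Rightarrow> schedule"
  assumes "continuous_on A f"
  shows "continuous_on A (\<lambda>p. f p i j)"
  by (rule continuous_on_product_then_coordinatewise[OF continuous_on_product_then_coordinatewise[OF assms]])

lemma continuous_on_P_bar:
  fixes f :: "'a::topological_space \<Rightarrow> schedule"
  assumes "continuous_on A f"
  shows "continuous_on A (\<lambda>p. P_bar S z (f p) i j)"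
proof (cases z)
  case (Pair x v)
  note entry = continuous_on_schedule_entry[OF assms]
  show ?thesis unfolding Pair
    by (cases "x j < \<alpha>min S j"; cases "(i, j) \<in> first_ops S x")
      (simp_all add: P_bar.simps Let_def continuous_on_add continuous_on_diff entry del: R_bar.simps)
qed

lemma continuous_on_T_bar:
  fixes f :: "'a::topological_space \<Rightarrow> schedule"
  assumes "continuous_on A f"
  shows "continuous_on A (\<lambda>p. T_bar S z (f p) i j)"
proof (cases z)
  case (Pair x v)
  note entry = continuous_on_schedule_entry[OF assms]
  show ?thesis unfolding Pair
    by (cases "x j < \<alpha>min S j"; cases "(i, j) \<in> first_ops S x")
      (simp_all add: T_bar.simps Let_def continuous_on_add continuous_on_diff entry del: R_bar.simps)
qed

lemma continuous_on_objective:
  fixes f :: "'a::topological_space \<Rightarrow> schedule"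
  assumes "continuous_on A f"
  shows "continuous_on A (\<lambda>p. objective S z (f p))"
  unfolding objective_def case_prod_beta
  by (rule continuous_on_Max_insert[OF finite_first_ops])
    (rule continuous_on_diff[OF continuous_on_schedule_entry[OF assms] continuous_on_const])

text \<open>
  After setting irrelevant entries to 0, feasible pairs lie in a product of compact sets: hitting times
  of a point are a compact interval, and binary variables range over \<open>{0, 1}\<close>.  The constraints are
  equations and non-strict inequalities between continuous functions of the pair, the binary variables carrying
  the discrete topology, so they cut out a closed and hence compact subset.
\<close>

lemma optimal_schedules_nonempty:
  assumes z: "z \<in> states S" and nonempty: "feasible S M z \<noteq> {}"
  shows "optimal_schedules S M z \<noteq> {}"
proof -
  obtain x v where zxv: "z = (x, v)" by (cases z)
  \<comment> \<open>A first operation that the vehicle has already entered is scheduled at 0 by convention; the same value pads all other entries.\<close>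
  define K where "K i j = (if (i, j) \<in> first_ops S x \<and> x j < \<alpha> S i j
    then hit_times S j (x j) (v j) (\<alpha> S i j) else {0})" for i j
  define C where "C = {T. \<forall>i. T i \<in> {g. \<forall>j. g j \<in> K i j}}"
  define B where "B = {k::nat \<Rightarrow> nat \<Rightarrow> nat \<Rightarrow> nat. \<forall>i. k i \<in> {g. \<forall>j. g j \<in> {h. \<forall>j'. h j' \<in> {0, 1}}}}"
  define F1 where "F1 = (\<Inter>(i, j)\<in>first_ops S x. {p::schedule \<times> (nat \<Rightarrow> nat \<Rightarrow> nat \<Rightarrow> nat).
      R_bar S z i j \<le> fst p i j})"
  define F2 where "F2 = (\<Inter>(i, j, j')\<in>arcs S x. {p::schedule \<times> (nat \<Rightarrow> nat \<Rightarrow> nat \<Rightarrow> nat).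
      P_bar S z (fst p) i j \<le> T_bar S z (fst p) i j' + M * (1 - real (snd p i j j')) \<and>
      P_bar S z (fst p) i j' \<le> T_bar S z (fst p) i j + M * (1 - real (snd p i j' j)) \<and>
      real (snd p i j j') + real (snd p i j' j) = 1})"
  have K: "compact (K i j)" for i j
  proof (cases "(i, j) \<in> first_ops S x \<and> x j < \<alpha> S i j")
    case True
    then have "vehicle_state j (x j) (v j)"
      using states_vehicle z zxv first_ops_vehicle by blast
    with True show ?thesis unfolding K_def by (simp add: min_time_attained(3))
  next
    case False
    then show ?thesis unfolding K_def by (simp only: if_False compact_sing)
  qed
  have C: "compact C" unfolding C_def by (intro compact_functions K)
  have B: "compact B" unfolding B_def by (intro compact_functions finite_imp_compact) simp
  have k: "continuous_on A (\<lambda>p::schedule \<times> (nat \<Rightarrow> nat \<Rightarrow> nat \<Rightarrow> nat). real (snd p i j j'))" for A i j j'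
    by (rule continuous_on_of_nat[OF continuous_on_product_then_coordinatewise[OF
          continuous_on_product_then_coordinatewise[OF continuous_on_product_then_coordinatewise[OF
          continuous_on_snd[OF continuous_on_id]]]]])
  have fst: "continuous_on UNIV (fst :: schedule \<times> (nat \<Rightarrow> nat \<Rightarrow> nat \<Rightarrow> nat) \<Rightarrow> schedule)"
    by (rule continuous_on_fst[OF continuous_on_id])
  note T = continuous_on_schedule_entry[OF fst]
    and P_bar = continuous_on_P_bar[OF fst] and T_bar = continuous_on_T_bar[OF fst]
  have "closed {p::schedule \<times> (nat \<Rightarrow> nat \<Rightarrow> nat \<Rightarrow> nat). R_bar S z i j \<le> fst p i j}" for i j
    by (rule closed_Collect_le[OF continuous_on_const T])
  then have "closed F1" unfolding F1_def by (intro closed_INT) auto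
  moreover have "closed {p::schedule \<times> (nat \<Rightarrow> nat \<Rightarrow> nat \<Rightarrow> nat).
      P_bar S z (fst p) i j \<le> T_bar S z (fst p) i j' + M * (1 - real (snd p i j j')) \<and>
      P_bar S z (fst p) i j' \<le> T_bar S z (fst p) i j + M * (1 - real (snd p i j' j)) \<and>
      real (snd p i j j') + real (snd p i j' j) = 1}" for i j j'
    by (intro closed_Collect_conj closed_Collect_le closed_Collect_eq continuous_on_add
        continuous_on_mult continuous_on_diff continuous_on_const P_bar T_bar k)
  then have "closed F2" unfolding F2_def by (intro closed_INT) auto
  ultimately have compact: "compact ((C \<times> B) \<inter> (F1 \<inter> F2))"
    by (intro compact_Int_closed compact_Times C B closed_Int)
  have sub: "p \<in> feasible S M z" if "p \<in> (C \<times> B) \<inter> (F1 \<inter> F2)" for p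
  proof -
    obtain T k where p: "p = (T, k)" by (cases p)
    have T: "T i j \<in> K i j" and kB: "k i j j' = 0 \<or> k i j j' = 1" for i j j'
      using that unfolding p C_def B_def by auto
    have "T \<in> schedule_domain S z"
      using T unfolding zxv K_def by (auto split: if_splits) (metis singletonD)+
    then show ?thesis
      using that kB unfolding p feasible_def F1_def F2_def zxv
      by (auto simp del: schedule_domain.simps R_bar.simps simp flip: of_nat_add)
  qed
  have sup: "(\<lambda>i j. if (i, j) \<in> first_ops S x then T i j else 0,
              \<lambda>i j j'. if (i, j, j') \<in> arcs S x then k i j j' else 0) \<in> (C \<times> B) \<inter> (F1 \<inter> F2)"
    (is "(?T, ?k) \<in> _") if "(T, k) \<in> feasible S M z" for T k
  proof -
    have "(?T, ?k) \<in> feasible S M z" using that by (rule feasible_cong) (simp_all add: zxv)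
    note feas = feasibleD[OF this, unfolded zxv fst_conv]
    have dom: "?T \<in> schedule_domain S z"
      and R: "\<And>i j. (i, j) \<in> first_ops S x \<Longrightarrow> R_bar S z i j \<le> ?T i j"
      and arc: "\<And>i j j'. (i, j, j') \<in> arcs S x \<Longrightarrow>
        ?k i j j' \<in> {0, 1} \<and> ?k i j' j \<in> {0, 1} \<and>
        P_bar S z ?T i j \<le> T_bar S z ?T i j' + M * (1 - real (?k i j j')) \<and>
        P_bar S z ?T i j' \<le> T_bar S z ?T i j + M * (1 - real (?k i j' j)) \<and>
        ?k i j j' + ?k i j' j = 1"
      unfolding zxv by (fact feas)+
    have "?T i j \<in> K i j" for i j
      using dom unfolding zxv K_def by fastforce
    then have "?T \<in> C" unfolding C_def by blast
    moreover have "?k \<in> B" unfolding B_def using arc by fastforce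
    moreover have "(?T, ?k) \<in> F1" unfolding F1_def using R by fastforce
    moreover have "(?T, ?k) \<in> F2"
      unfolding F2_def
    proof (intro INT_I, clarify, intro conjI)
      fix i j j' assume a: "(i, j, j') \<in> arcs S x"
      have "real (?k i j j') + real (?k i j' j) = 1" using arc[OF a] by linarith
      then show "real (snd (?T, ?k) i j j') + real (snd (?T, ?k) i j' j) = 1" by simp
      show "P_bar S z (fst (?T, ?k)) i j
          \<le> T_bar S z (fst (?T, ?k)) i j' + M * (1 - real (snd (?T, ?k) i j j'))"
        and "P_bar S z (fst (?T, ?k)) i j'
          \<le> T_bar S z (fst (?T, ?k)) i j + M * (1 - real (snd (?T, ?k) i j' j))"
        unfolding fst_conv snd_conv using arc[OF a] by blast+
    qed
    ultimately show ?thesis by blast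
  qed
  obtain p0 where "p0 \<in> feasible S M z" using nonempty by blast
  then have "(C \<times> B) \<inter> (F1 \<inter> F2) \<noteq> {}" using sup[of "fst p0" "snd p0"] by auto
  from continuous_attains_inf[OF compact this continuous_on_objective[OF continuous_on_fst[OF continuous_on_id]]]
  obtain p where p: "p \<in> (C \<times> B) \<inter> (F1 \<inter> F2)"
    and least: "\<And>q. q \<in> (C \<times> B) \<inter> (F1 \<inter> F2) \<Longrightarrow> objective S z (fst p) \<le> objective S z (fst q)"
    by blast
  have le: "objective S z (fst p) \<le> objective S z T" if "(T, k) \<in> feasible S M z" for T k
  proof -
    have "objective S z (\<lambda>i j. if (i, j) \<in> first_ops S x then T i j else 0) = objective S z T"
      by (rule objective_cong) (simp add: zxv)
    then show ?thesis using least[OF sup[OF that]] by simp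
  qed
  have "s_U S M z = ereal (objective S z (fst p))"
    unfolding s_U_def
  proof (rule antisym)
    show "(INF (T, k)\<in>feasible S M z. ereal (objective S z T)) \<le> ereal (objective S z (fst p))"
      using sub[OF p] by (intro INF_lower2[of p]) (auto simp: case_prod_beta)
    show "ereal (objective S z (fst p)) \<le> (INF (T, k)\<in>feasible S M z. ereal (objective S z T))"
      using le by (intro INF_greatest) auto
  qed
  then have "fst p \<in> optimal_schedules S M z"
    unfolding optimal_schedules_def using sub[OF p] by (intro CollectI exI[of _ "snd p"]) simp
  then show ?thesis by blast
qed

section \<open>The supervisor\<close>

definition recoverable :: "real \<Rightarrow> state \<Rightarrow> bool" where
  "recoverable M z \<longleftrightarrow> z \<in> states S \<and> s_U S M z = 0"

text \<open>
  An infimum of 0 over the feasible schedules yields a feasible schedule of delay 0 because it is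
  attained.
\<close>

lemma recoverable_iff:
  "recoverable M z \<longleftrightarrow> z \<in> states S \<and> (\<exists>T k. (T, k) \<in> feasible S M z \<and> objective S z T = 0)"
proof
  assume r: "recoverable M z"
  then have "feasible S M z \<noteq> {}" unfolding recoverable_def s_U_def by (auto simp: top_ereal_def)
  then obtain T where "T \<in> optimal_schedules S M z"
    using optimal_schedules_nonempty r unfolding recoverable_def by blast
  then show "z \<in> states S \<and> (\<exists>T k. (T, k) \<in> feasible S M z \<and> objective S z T = 0)"
    using r unfolding recoverable_def optimal_schedules_def by auto
next
  assume "z \<in> states S \<and> (\<exists>T k. (T, k) \<in> feasible S M z \<and> objective S z T = 0)"
  then obtain T k where z: "z \<in> states S" and T: "(T, k) \<in> feasible S M z" "objective S z T = 0" by blast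
  have "s_U S M z \<le> 0"
    unfolding s_U_def by (rule INF_lower2[OF T(1)]) (simp add: T(2))
  moreover have "0 \<le> s_U S M z"
    unfolding s_U_def by (intro INF_greatest) (auto simp: objective_nonneg)
  ultimately show "recoverable M z" using z unfolding recoverable_def by simp
qed

lemma recoverable_evolve:
  assumes r: "recoverable M z" and T: "T \<in> optimal_schedules S M z"
    and u: "u \<in> generated_signals S z T" and s: "0 \<le> s"
  shows "recoverable M (evolve S s u z)"
proof -
  obtain x v where z: "z = (x, v)" by (cases z)
  obtain x' v' where z': "evolve S s u (x, v) = (x', v')" by (cases "evolve S s u (x, v)")
  obtain k where k: "(T, k) \<in> feasible S M z" "objective S z T = 0"
    using r T unfolding recoverable_def optimal_schedules_def by auto
  have "(x, v) \<in> states S" using r z unfolding recoverable_def by simp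
  note step = this feasible_zero_prompt[OF k, unfolded z] u[unfolded z] s z'
  show ?thesis
    unfolding recoverable_iff z z'
    using evolved_states[OF step] feasible_advance[OF step k(1)[unfolded z]]
      objective_advance[OF step] by blast
qed

definition safe_signal :: "real \<Rightarrow> real \<Rightarrow> state \<Rightarrow> signals \<Rightarrow> bool" where
  "safe_signal M \<tau> z u \<longleftrightarrow> (\<forall>j\<in>vehicles S. u j \<in> sig_space S j) \<and> recoverable M (evolve S \<tau> u z)"

lemma approx_verificationD:
  assumes "approx_verification S M AV"
  shows "fst (AV z) = s_U S M z" "selects (optimal_schedules S M z) (snd (AV z))"
  using assms unfolding approx_verification_def by blast+

lemma verification_and_generation_succeed:
  assumes AV: "approx_verification S M AV" and \<sigma>: "input_generator S \<sigma>" and \<tau>: "0 \<le> \<tau>"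
    and r: "recoverable M z"
  obtains T u where "AV z = (0, Some T)" "\<sigma> z T = Some u" "safe_signal M \<tau> z u"
proof -
  obtain x v where z: "z = (x, v)" by (cases z)
  have states: "(x, v) \<in> states S" using r z unfolding recoverable_def by simp
  have "feasible S M z \<noteq> {}" using r unfolding recoverable_iff by blast
  then have "optimal_schedules S M z \<noteq> {}"
    using optimal_schedules_nonempty r unfolding recoverable_def by blast
  moreover have "fst (AV z) = 0" "selects (optimal_schedules S M z) (snd (AV z))"
    using approx_verificationD[OF AV, of z] r unfolding recoverable_def by simp_all
  ultimately obtain T where T: "AV z = (0, Some T)" "T \<in> optimal_schedules S M z"
    unfolding selects_def by (cases "AV z") (auto split: option.splits)
  then obtain k where "(T, k) \<in> feasible S M z" unfolding optimal_schedules_def by blast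
  then have "generated_signals S z T \<noteq> {}"
    using generated_signals_nonempty[OF states] feasibleD(1) unfolding z by blast
  moreover have "selects (generated_signals S z T) (\<sigma> z T)" using \<sigma> unfolding input_generator_def by blast
  ultimately obtain u where u: "\<sigma> z T = Some u" "u \<in> generated_signals S z T"
    unfolding selects_def by (auto split: option.splits)
  have "safe_signal M \<tau> z u"
    unfolding safe_signal_def
    using recoverable_evolve[OF r T(2) u(2) \<tau>] generated_signals_sig[OF u(2)[unfolded z]] by blast
  then show thesis by (rule that[OF T(1) u(1)])
qed

text \<open>
  The hypothesis on \<open>stored\<close> is the invariant of the closed loop.  Its first alternative covers the
  initial step, at which no safe signal is stored.
\<close>

lemma supervisor_succeeds:
  assumes AV: "approx_verification S M AV" and \<sigma>: "input_generator S \<sigma>" and \<tau>: "0 \<le> \<tau>"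
    and stored: "s_U S M (evolve S \<tau> (\<lambda>j t. w j) z) = 0 \<or>
      (\<exists>u. stored = Some u \<and> safe_signal M \<tau> z u)"
    and z: "z \<in> states S" and w: "w \<in> inputs S"
  obtains u safe where "supervisor S \<tau> AV \<sigma> z stored w = Some (u, safe)"
    "evolve S \<tau> u z \<in> states S" "safe_signal M \<tau> (evolve S \<tau> u z) safe"
proof -
  let ?zd = "evolve S \<tau> (\<lambda>j t. w j) z"
  have "(\<lambda>t. w j) \<in> sig_space S j" if "j \<in> vehicles S" for j
    using constant_signal[OF that] w that unfolding inputs_def by auto
  then have zd: "?zd \<in> states S" using evolve_states[OF z _ \<tau>, of "\<lambda>j t. w j"] by blast
  show thesis
  proof (cases "s_U S M ?zd = 0")
    case True
    then have "recoverable M ?zd" using zd unfolding recoverable_def by simp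
    then obtain T safe where "AV ?zd = (0, Some T)" "\<sigma> ?zd T = Some safe" "safe_signal M \<tau> ?zd safe"
      by (rule verification_and_generation_succeed[OF AV \<sigma> \<tau>])
    then show thesis using zd by (intro that) (simp_all add: supervisor_def)
  next
    case False
    then have not_zero: "fst (AV ?zd) \<noteq> 0" using approx_verificationD(1)[OF AV, of ?zd] by simp
    from False stored obtain u where u: "stored = Some u" "safe_signal M \<tau> z u" by blast
    let ?zs = "evolve S \<tau> u z"
    have rs: "recoverable M ?zs" using u(2) unfolding safe_signal_def by simp
    then obtain T safe where "AV ?zs = (0, Some T)" "\<sigma> ?zs T = Some safe" "safe_signal M \<tau> ?zs safe"
      by (rule verification_and_generation_succeed[OF AV \<sigma> \<tau>])
    then show thesis using rs not_zero u(1)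
      by (intro that[of u safe]) (simp_all add: supervisor_def recoverable_def case_prod_beta Let_def)
  qed
qed

end

theorem theorem6:
  fixes S :: intersection and \<tau> M :: real
    and AV :: "state \<Rightarrow> ereal \<times> schedule option"
    and \<sigma> :: "state \<Rightarrow> schedule \<Rightarrow> signals option"
    and z0 :: state and ud :: "nat \<Rightarrow> input"
  assumes "intersection_model S"
    and "continuous_inputs S"
    and "monotone_flow S"
    and "\<tau> > 0" and "M > 0"
    and "approx_verification S M AV"
    and "input_generator S \<sigma>"
    and "z0 \<in> states S"
    and "\<And>k. ud k \<in> inputs S"
    and "supervisor S \<tau> AV \<sigma> z0 None (ud 0) \<noteq> None"
  shows "\<forall>k. \<exists>z stored. closed_loop S \<tau> AV \<sigma> z0 ud k = Some (z, stored) \<and>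
           supervisor S \<tau> AV \<sigma> z stored (ud k) \<noteq> None"
proof
  interpret controlled_intersection S by unfold_locales fact+
  have \<tau>: "0 \<le> \<tau>" using \<open>\<tau> > 0\<close> by simp
  note succeeds = supervisor_succeeds[OF \<open>approx_verification S M AV\<close> \<open>input_generator S \<sigma>\<close> \<tau>
      _ _ \<open>\<And>k. ud k \<in> inputs S\<close>]
  have start: "s_U S M (evolve S \<tau> (\<lambda>j t. ud 0 j) z0) = 0"
    using \<open>supervisor S \<tau> AV \<sigma> z0 None (ud 0) \<noteq> None\<close>
      approx_verificationD(1)[OF \<open>approx_verification S M AV\<close>]
    by (auto simp: supervisor_def Let_def case_prod_beta split: if_splits)
  have invariant: "\<exists>z stored. closed_loop S \<tau> AV \<sigma> z0 ud k = Some (z, stored) \<and> z \<in> states S \<and>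
      (s_U S M (evolve S \<tau> (\<lambda>j t. ud k j) z) = 0 \<or> (\<exists>u. stored = Some u \<and> safe_signal M \<tau> z u))"
    for k
  proof (induction k)
    case 0
    then show ?case using start \<open>z0 \<in> states S\<close> by simp
  next
    case (Suc k)
    then obtain z stored where loop: "closed_loop S \<tau> AV \<sigma> z0 ud k = Some (z, stored)"
      and z: "z \<in> states S" and
      stored: "s_U S M (evolve S \<tau> (\<lambda>j t. ud k j) z) = 0 \<or> (\<exists>u. stored = Some u \<and> safe_signal M \<tau> z u)"
      by blast
    obtain u safe where "supervisor S \<tau> AV \<sigma> z stored (ud k) = Some (u, safe)"
      "evolve S \<tau> u z \<in> states S" "safe_signal M \<tau> (evolve S \<tau> u z) safe"
      by (rule succeeds[OF stored z])
    then show ?case using loop by simp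
  qed
  fix k
  from invariant[of k] obtain z stored where loop: "closed_loop S \<tau> AV \<sigma> z0 ud k = Some (z, stored)"
    and z: "z \<in> states S" and
    stored: "s_U S M (evolve S \<tau> (\<lambda>j t. ud k j) z) = 0 \<or> (\<exists>u. stored = Some u \<and> safe_signal M \<tau> z u)"
    by blast
  obtain u safe where "supervisor S \<tau> AV \<sigma> z stored (ud k) = Some (u, safe)"
    by (rule succeeds[OF stored z])
  with loop show "\<exists>z stored. closed_loop S \<tau> AV \<sigma> z0 ud k = Some (z, stored) \<and>
      supervisor S \<tau> AV \<sigma> z stored (ud k) \<noteq> None"
    by auto
qed

end
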